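(* Let $r>0$ satisfy $r+\alpha<\frac{E_{\min}^2\,\min_{i,j}\mathbf G(i,j)^{1/2}}{2E_{\max}}$ and put $\eta=\frac{E_{\min}^2\,\min_{i,j}\mathbf G(i,j)^{1/2}}{4(2\tau+1)E_{\max}}$. Let $\rho\in[0,1]$ (depending on $r$ and $\eta$ but not on $\boldsymbol\beta$) and $\mu\in[0,1]$ (depending on $\eta$ but not on $\boldsymbol\beta$ and $r$) be correlation levels such that: (i) for all $k\in P_0$ there is an integer $m\in\mathcal T_\rho(k)$ so that $\|\widehat{\boldsymbol\beta}_m(r)\|_1\ge\eta$ with probability greater than $$1-p\,\mathfrak t\Bigl(\sqrt N\,\frac{E_{\min}^2\min_{i,j}\mathbf G(i,j)^{1/2}}{4E_{\max}\sigma}\Bigr)-p(2\tau+1)\,\mathfrak t\Bigl(\sqrt N\,\frac{r-\alpha}{\sigma}\Bigr);$$ (ii) for any $k$ satisfying $\|\widehat{\boldsymbol\beta}_k(r)\|_1\ge\eta$, $\Pr(P_0\cap\mathcal T_\mu(k)\ne\emptyset)>1-\|\widehat{\boldsymbol\beta}_k(r)\|_0\,\mathfrak t\bigl(\sqrt N\,\frac{r-\alpha}{\sigma}\bigr)$. Let $a_\rho,a_\mu$ be the integers satisfying $V_{a_\rho}(k)=\mathcal T_\rho(k)$ and $V_{a_\mu}(k)=\mathcal T_\mu(k)$ for any integer $k\in[\tau,N-1-\tau]$. Then $$\widehat\lambda(r,\eta)-\lambda_{opt}\le\widehat\lambda(r,\eta)\left[1-\frac{\widehat T_{\widehat M}/\Delta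 t}{a_\rho+\max J(\widehat{\boldsymbol\beta}(r,\eta))}\cdot\frac{I\bigl(\bigcup_{1\le j\le\widehat M}V_{a_\mu}(\widehat T_j/\Delta t)\bigr)}{\widehat M}\right]$$ with probability greater than $$1-p\,\mathfrak t\Bigl(\sqrt N\,\frac{E_{\min}^2\min_{i,j}\mathbf G(i,j)^{1/2}}{4E_{\max}\sigma}\Bigr)-p(2\tau+1)\,\mathfrak t\Bigl(\sqrt N\,\frac{r-\alpha}{\sigma}\Bigr)-\|\widehat{\boldsymbol\beta}(r)\|_0\,\mathfrak t\Bigl(\sqrt N\,\frac{r-\alpha}{\sigma}\Bigr).$$
   Context: Observation model. $N$ is an even integer, $\Delta t>0$, $t_i=i\Delta t$ for $0\le i\le N-1$. One observes $\mathbf y=(y_0,\dots,y_{N-1})^T$ with $y_i=\sum_{n=1}^M E_n\Phi_n(t_i-T_n)+\varepsilon_i$, where $T_1<\dots<T_M$ is the sample path of a homogeneous Poisson process of intensity $\lambda$, the $E_n$ are iid random variables with $0<E_{\min}\le E_n\le E_{\max}$ for known constants $E_{\min},E_{\max}$, the $\Phi_n$ are (unknown) pulse shapes, and $\boldsymbol\varepsilon=(\varepsilon_0,\dots,\varepsilon_{N-1})^T$ has iid Gaussian entries with mean $0$ and variance $\sigma^2$. Let $\overline{\mathbf y}=\mathbf y-\boldsymbol\varepsilon$ be the noise-free part. Let $P_0=\{\lfloor T_n/\Delta t\rfloor:\ n=1,\dots,M\}\subset\{0,\dots,N-1\}$, where here $\lfloor x\rfloor$ denotes the integer closest to $x$.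 Dictionary. Given $p$ pairs of gamma-shape parameters $(\theta_1^{(s)},\theta_2^{(s)})$, $s=1,\dots,p$, and a positive integer $\tau$, let $\Gamma_s(t)=c_s t^{\theta_1^{(s)}}\exp(-\theta_2^{(s)}t)\mathbf 1(0<t\le\tau\Delta t)$, with $c_s$ such that $\frac1N\sum_{i=0}^{N-1}\Gamma_s(t_i)^2=1$. The $k$-th time block is the $N\times p$ matrix $\mathbf A_k=[\Gamma_s(t_i-t_k)]_{0\le i\le N-1,\,1\le s\le p}$, and $\mathbf A=[\mathbf A_0\ \mathbf A_1\cdots\mathbf A_{N-1}]$ is $N\times Np$. For $I,J\subset\{0,\dots,N-1\}$, $\mathbf A_I$ is the concatenation of the blocks $\mathbf A_k$, $k\in I$, and $\mathbf G_{I,J}=\frac1N\mathbf A_I^T\mathbf A_J$. $\mathbf G=\frac1N\mathbf A_k^T\mathbf A_k$ is the Gram matrix of one time block, regarded as independent of $k$. A vector $\mathbf b\in\mathbb R^{Np}$ is split into blocks $\mathbf b=[\mathbf b_0^T,\dots,\mathbf b_{N-1}^T]^T$, $\mathbf b_i\in\mathbb R^p$; $J(\mathbf b)=\{i:\mathbf b_i\ne0\}$; $\|\cdot\|_0$ is the number of nonzero entries. Approximate model. $\mathbf y=\mathbf A\boldsymbol\beta+\boldsymbol\delta+\boldsymbol\varepsilon$ with $\boldsymbol\delta=\overline{\mathbf y}-\mathbf A\boldsymbol\beta$, where $\boldsymbol\beta$ has $\boldsymbol\beta_i=0$ for $i\notin P_0$ and, for $i\in P_0$, $\boldsymbol\beta_i\in\mathbb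 R_+^p$ with $E_{\min}\le\frac1{\sqrt N}\|\mathbf A_i\boldsymbol\beta_i\|_2\le E_{\max}$. The discrepancy is $\alpha=\|\boldsymbol\delta\|_2/\sqrt N$. Neighborhoods. For $k\in\{0,\dots,N-1\}$ and real $a>0$, $V_a(k)=[k-a,k+a]\cap\{0,\dots,N-1\}$. For $\rho\in[0,1]$, $\mathcal T_\rho(k)=\{0,\dots,N-1\}\setminus\{j:\max|\mathbf G_{\{k\},\{j\}}|<\rho\}$, the max being over the entries of the matrix. For $X\subset\{0,\dots,N-1\}$ written as a union of discrete intervals, $I(X)$ is the number of maximal discrete intervals composing $X$. $\mathfrak t(x)=\frac1{x\sqrt{2\pi}}e^{-x^2/2}$. Estimator. $\widehat{\boldsymbol\beta}(r)$ is the minimizer over $\mathbf b\in\mathbb R^{Np}$, $\mathbf b\ge0$ entrywise, of $\frac1{2N}\|\mathbf y-\mathbf A\mathbf b\|_2^2+r\|\mathbf b\|_1$ (non-negative LASSO). $\widehat{\boldsymbol\beta}(r,\eta)$ is obtained by replacing by $0$ every block $\widehat{\boldsymbol\beta}_k(r)$ except those with $\|\widehat{\boldsymbol\beta}_k(r)\|_1>\eta$. $\widehat T_1<\widehat T_2<\dots<\widehat T_{\widehat M}$ are the times $k\Delta t$, $1\le k\le N-1$, such that block $k-1$ of $\widehat{\boldsymbol\beta}(r,\eta)$ is zero and block $k$ is nonzero, and $\widehat M$ is the number of such $k$. Finally $\widehat\lambda(r,\eta)=\widehat M/\widehat T_{\widehat M}$ and $\lambda_{opt}=\frac{|P_0|}{\Delta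 t\,\max P_0}$.
   Formalization: The random counts of nonzero entries of the estimator in (ii) and in the final probability bound, which make a probability exceed a random level, are replaced by their expectations over the noise; probabilities are over the noise with the sample path fixed. *)

theory Defs
  imports "HOL-Probability.Probability"
begin

text \<open>
  Sample indices and time blocks are natural numbers below \<open>N\<close>, shapes are natural numbers below
  \<open>p\<close>.  A dictionary is a function \<open>A\<close> with \<open>A k s i\<close> the entry of block \<open>k\<close> in column \<open>s\<close> and
  row \<open>i\<close>; a coefficient vector of length \<open>N * p\<close> is a function \<open>b\<close> with \<open>b k s\<close> the component
  \<open>s\<close> of block \<open>k\<close>.  Values outside these index ranges are never used.
\<close>

section \<open>Observation model\<close>

text \<open>Arrival times are indexed from 1; the first interarrival time is \<open>T 1\<close> itself.\<close>

definition interarrival :: "(nat \<Rightarrow> 'w \<Rightarrow> real) \<Rightarrow> nat \<Rightarrow> 'w \<Rightarrow> real" where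
  "interarrival T n \<omega> = (if n = 1 then T 1 \<omega> else T n \<omega> - T (n - 1) \<omega>)"

definition poisson_arrivals :: "'w measure \<Rightarrow> real \<Rightarrow> (nat \<Rightarrow> 'w \<Rightarrow> real) \<Rightarrow> bool" where
  "poisson_arrivals S l T \<longleftrightarrow>
     0 < l \<and>
     prob_space.indep_vars S (\<lambda>_. borel) (interarrival T) {1..} \<and>
     (\<forall>n\<ge>1. distributed S lborel (interarrival T n) (\<lambda>x. ennreal (exponential_density l x))) \<and>
     (\<forall>\<omega>\<in>space S. 0 < T 1 \<omega> \<and> (\<forall>n\<ge>1. T n \<omega> < T (Suc n) \<omega>))"

definition iid :: "'w measure \<Rightarrow> 'i set \<Rightarrow> ('i \<Rightarrow> 'w \<Rightarrow> real) \<Rightarrow> bool" where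
  "iid S I X \<longleftrightarrow>
     prob_space.indep_vars S (\<lambda>_. borel) X I \<and>
     (\<forall>i\<in>I. \<forall>j\<in>I. distr S borel (X i) = distr S borel (X j))"

definition gaussian_noise :: "'e measure \<Rightarrow> nat \<Rightarrow> real \<Rightarrow> (nat \<Rightarrow> 'e \<Rightarrow> real) \<Rightarrow> bool" where
  "gaussian_noise Q N \<sigma> \<epsilon> \<longleftrightarrow>
     prob_space.indep_vars Q (\<lambda>_. borel) \<epsilon> {..<N} \<and>
     (\<forall>i<N. distributed Q lborel (\<epsilon> i) (\<lambda>x. ennreal (normal_density 0 \<sigma> x)))"

definition clean_signal ::
  "real \<Rightarrow> nat \<Rightarrow> (nat \<Rightarrow> real) \<Rightarrow> (nat \<Rightarrow> real) \<Rightarrow> (nat \<Rightarrow> real \<Rightarrow> real) \<Rightarrow> nat \<Rightarrow> real" where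
  "clean_signal dt m T E \<Phi> i = (\<Sum>n=1..m. E n * \<Phi> n (real i * dt - T n))"

definition arrival_bins :: "real \<Rightarrow> nat \<Rightarrow> (nat \<Rightarrow> real) \<Rightarrow> nat set" where
  "arrival_bins dt m T = (\<lambda>n. nat (round (T n / dt))) ` {1..m}"

section \<open>Dictionary\<close>

definition raw_gamma :: "real \<Rightarrow> nat \<Rightarrow> real \<Rightarrow> real \<Rightarrow> real \<Rightarrow> real" where
  "raw_gamma dt \<tau> a b t =
     (if 0 < t \<and> t \<le> real \<tau> * dt then t powr a * exp (- b * t) else 0)"

text \<open>The constant is the positive one for which the mean of the squared samples is 1.\<close>

definition gamma_shape :: "nat \<Rightarrow> real \<Rightarrow> nat \<Rightarrow> real \<Rightarrow> real \<Rightarrow> real \<Rightarrow> real" where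
  "gamma_shape N dt \<tau> a b t =
     sqrt (real N / (\<Sum>i<N. (raw_gamma dt \<tau> a b (real i * dt))\<^sup>2)) * raw_gamma dt \<tau> a b t"

definition dictionary ::
  "nat \<Rightarrow> real \<Rightarrow> nat \<Rightarrow> (nat \<Rightarrow> real) \<Rightarrow> (nat \<Rightarrow> real) \<Rightarrow> nat \<Rightarrow> nat \<Rightarrow> nat \<Rightarrow> real" where
  "dictionary N dt \<tau> \<theta>1 \<theta>2 k s i =
     gamma_shape N dt \<tau> (\<theta>1 s) (\<theta>2 s) (real i * dt - real k * dt)"

definition block_apply :: "nat \<Rightarrow> (nat \<Rightarrow> nat \<Rightarrow> nat \<Rightarrow> real) \<Rightarrow> nat \<Rightarrow> (nat \<Rightarrow> real) \<Rightarrow> nat \<Rightarrow> real" where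
  "block_apply p A k c i = (\<Sum>s<p. A k s i * c s)"

definition dict_apply ::
  "nat \<Rightarrow> nat \<Rightarrow> (nat \<Rightarrow> nat \<Rightarrow> nat \<Rightarrow> real) \<Rightarrow> (nat \<Rightarrow> nat \<Rightarrow> real) \<Rightarrow> nat \<Rightarrow> real" where
  "dict_apply N p A b i = (\<Sum>k<N. block_apply p A k (b k) i)"

definition gram :: "nat \<Rightarrow> (nat \<Rightarrow> nat \<Rightarrow> nat \<Rightarrow> real) \<Rightarrow> nat \<Rightarrow> nat \<Rightarrow> nat \<Rightarrow> nat \<Rightarrow> real" where
  "gram N A k j s s' = (1 / real N) * (\<Sum>i<N. A k s i * A j s' i)"

text \<open>
  The Gram matrix of one time block is read off block 0, which is never cut by the end of the
  observation window; all blocks \<open>k\<close> with \<open>k + \<tau> < N\<close> have the same one.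
\<close>

definition min_sqrt_gram :: "nat \<Rightarrow> nat \<Rightarrow> (nat \<Rightarrow> nat \<Rightarrow> nat \<Rightarrow> real) \<Rightarrow> real" where
  "min_sqrt_gram N p A = Min ((\<lambda>(s, s'). sqrt (gram N A 0 0 s s')) ` ({..<p} \<times> {..<p}))"

section \<open>Neighborhoods\<close>

definition nbhd :: "nat \<Rightarrow> real \<Rightarrow> real \<Rightarrow> nat set" where
  "nbhd N a x = {j. j < N \<and> x - a \<le> real j \<and> real j \<le> x + a}"

definition corr_nbhd :: "nat \<Rightarrow> nat \<Rightarrow> (nat \<Rightarrow> nat \<Rightarrow> nat \<Rightarrow> real) \<Rightarrow> real \<Rightarrow> nat \<Rightarrow> nat set" where
  "corr_nbhd N p A \<rho> k =
     {..<N} - {j. Max ((\<lambda>(s, s'). \<bar>gram N A k j s s'\<bar>) ` ({..<p} \<times> {..<p})) < \<rho>}"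

text \<open>
  \<open>a\<close> is \<^emph>\<open>the\<close> integer for which the two kinds of neighborhoods agree in the interior of the
  window: it has this property and no other integer has it.
\<close>

definition is_corr_radius ::
  "nat \<Rightarrow> nat \<Rightarrow> nat \<Rightarrow> (nat \<Rightarrow> nat \<Rightarrow> nat \<Rightarrow> real) \<Rightarrow> real \<Rightarrow> int \<Rightarrow> bool" where
  "is_corr_radius N p \<tau> A \<rho> a \<longleftrightarrow>
     (\<forall>a'::int. (\<forall>k. \<tau> \<le> k \<and> k + \<tau> \<le> N - 1 \<longrightarrow>
                   nbhd N (real_of_int a') (real k) = corr_nbhd N p A \<rho> k) \<longleftrightarrow> a' = a)"

definition num_intervals :: "nat set \<Rightarrow> nat" where
  "num_intervals X =
     card {D. (\<exists>a b. a \<le> b \<and> D = {a..b}) \<and> D \<subseteq> X \<and>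
              (\<forall>a b. D \<subseteq> {a..b} \<and> {a..b} \<subseteq> X \<longrightarrow> {a..b} = D)}"

section \<open>Estimator\<close>

definition block_norm1 :: "nat \<Rightarrow> (nat \<Rightarrow> real) \<Rightarrow> real" where
  "block_norm1 p c = (\<Sum>s<p. \<bar>c s\<bar>)"

definition block_norm0 :: "nat \<Rightarrow> (nat \<Rightarrow> real) \<Rightarrow> nat" where
  "block_norm0 p c = card {s. s < p \<and> c s \<noteq> 0}"

definition norm0 :: "nat \<Rightarrow> nat \<Rightarrow> (nat \<Rightarrow> nat \<Rightarrow> real) \<Rightarrow> nat" where
  "norm0 N p b = card {(k, s). k < N \<and> s < p \<and> b k s \<noteq> 0}"

definition lasso_objective ::
  "nat \<Rightarrow> nat \<Rightarrow> (nat \<Rightarrow> nat \<Rightarrow> nat \<Rightarrow> real) \<Rightarrow> (nat \<Rightarrow> real) \<Rightarrow> real \<Rightarrow> (nat \<Rightarrow> nat \<Rightarrow> real) \<Rightarrow> real" where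
  "lasso_objective N p A y r b =
     1 / (2 * real N) * (L2_set (\<lambda>i. y i - dict_apply N p A b i) {..<N})\<^sup>2
     + r * (\<Sum>k<N. block_norm1 p (b k))"

text \<open>\<open>b\<close> is \<^emph>\<open>the\<close> minimizer, i.e. every other feasible vector has a larger objective.\<close>

definition is_nn_lasso ::
  "nat \<Rightarrow> nat \<Rightarrow> (nat \<Rightarrow> nat \<Rightarrow> nat \<Rightarrow> real) \<Rightarrow> (nat \<Rightarrow> real) \<Rightarrow> real \<Rightarrow> (nat \<Rightarrow> nat \<Rightarrow> real) \<Rightarrow> bool" where
  "is_nn_lasso N p A y r b \<longleftrightarrow>
     (\<forall>k<N. \<forall>s<p. 0 \<le> b k s) \<and>
     (\<forall>b'. (\<forall>k<N. \<forall>s<p. 0 \<le> b' k s) \<and> (\<exists>k<N. \<exists>s<p. b' k s \<noteq> b k s) \<longrightarrow>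
           lasso_objective N p A y r b < lasso_objective N p A y r b')"

definition threshold :: "nat \<Rightarrow> real \<Rightarrow> (nat \<Rightarrow> nat \<Rightarrow> real) \<Rightarrow> nat \<Rightarrow> nat \<Rightarrow> real" where
  "threshold p \<eta> b k = (if block_norm1 p (b k) > \<eta> then b k else (\<lambda>_. 0))"

definition block_support :: "nat \<Rightarrow> nat \<Rightarrow> (nat \<Rightarrow> nat \<Rightarrow> real) \<Rightarrow> nat set" where
  "block_support N p b = {k. k < N \<and> (\<exists>s<p. b k s \<noteq> 0)}"

definition onsets :: "nat \<Rightarrow> nat \<Rightarrow> (nat \<Rightarrow> nat \<Rightarrow> real) \<Rightarrow> nat set" where
  "onsets N p b =
     {k. 1 \<le> k \<and> k \<le> N - 1 \<and> k - 1 \<notin> block_support N p b \<and> k \<in> block_support N p b}"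

definition num_arrivals_est :: "nat \<Rightarrow> nat \<Rightarrow> (nat \<Rightarrow> nat \<Rightarrow> real) \<Rightarrow> nat" where
  "num_arrivals_est N p b = card (onsets N p b)"

text \<open>Estimated arrival times, indexed from 1 to \<open>num_arrivals_est N p b\<close>.\<close>

definition arrival_est :: "nat \<Rightarrow> nat \<Rightarrow> real \<Rightarrow> (nat \<Rightarrow> nat \<Rightarrow> real) \<Rightarrow> nat \<Rightarrow> real" where
  "arrival_est N p dt b j = real (sorted_list_of_set (onsets N p b) ! (j - 1)) * dt"

text \<open>This is 0 if no arrival is detected, whatever the denominator.\<close>

definition rate_est :: "nat \<Rightarrow> nat \<Rightarrow> real \<Rightarrow> (nat \<Rightarrow> nat \<Rightarrow> real) \<Rightarrow> real" where
  "rate_est N p dt b =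
     real (num_arrivals_est N p b) / arrival_est N p dt b (num_arrivals_est N p b)"

text \<open>
  Extended real, since the denominator vanishes if all arrivals fall into bin 0; the rate is then
  infinite.  If there is no arrival at all, it is 0.
\<close>

definition rate_opt :: "real \<Rightarrow> nat set \<Rightarrow> ereal" where
  "rate_opt dt P0 = ereal (real (card P0)) / ereal (dt * real (Max P0))"

definition tail :: "real \<Rightarrow> real" where
  "tail x = 1 / (x * sqrt (2 * pi)) * exp (- x\<^sup>2 / 2)"

end

theory Submission
  imports Defs
begin

text \<open>
  If every block with \<open>\<eta> \<le> \<parallel>\<beta>\<^sub>k\<parallel>\<^sub>1\<close> has a true arrival in its neighbourhood, then so does every maximal
  interval of the union of neighbourhoods, which gives \<open>I(\<dots>) \<le> |P\<^sub>0|\<close>; if a neighbour of the last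
  arrival is detected, then \<open>max P\<^sub>0 \<le> a\<^sub>\<rho> + max J\<close>.  The two bounds together are the asserted
  inequality, and a union bound over the failing events gives the probability.

  Three points need care.  The levels use \<open>\<eta> \<le> \<parallel>\<beta>\<^sub>k\<parallel>\<^sub>1\<close> but the estimator keeps only
  \<open>\<eta> < \<parallel>\<beta>\<^sub>k\<parallel>\<^sub>1\<close>: equality has probability 0, since on each active set it confines the noise to a
  hyperplane.  The radii are specified only in the interior of the window: near its end the
  correlations can only decrease, so the neighbourhoods remain bounded by the radii.  Finally \<open>r \<le> \<alpha>\<close>
  would make the tail term of the second level non-positive and hence require a probability above 1
  for some block, because Gaussian noise makes large blocks possible.
\<close>

section \<open>Neighborhoods near the end of the window\<close>

lemma dictionary_nonneg: "0 \<le> dictionary N dt \<tau> \<theta>1 \<theta>2 k s i"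
proof -
  have "0 \<le> raw_gamma dt \<tau> a b t" for a b t
    by (simp add: raw_gamma_def)
  then show ?thesis
    unfolding dictionary_def gamma_shape_def
    by (intro mult_nonneg_nonneg) (auto intro!: divide_nonneg_nonneg sum_nonneg)
qed

lemma dictionary_shift:
  "dictionary N dt \<tau> \<theta>1 \<theta>2 (k + l) s (k + n) = dictionary N dt \<tau> \<theta>1 \<theta>2 l s n"
  by (simp add: dictionary_def algebra_simps)

lemma dictionary_eq_0:
  assumes "0 < dt" "i \<le> k \<or> k + \<tau> < i"
  shows "dictionary N dt \<tau> \<theta>1 \<theta>2 k s i = 0"
proof -
  have "\<not> (0 < real i * dt - real k * dt \<and> real i * dt - real k * dt \<le> real \<tau> * dt)"
  proof
    assume "0 < real i * dt - real k * dt \<and> real i * dt - real k * dt \<le> real \<tau> * dt"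
    then have "real k * dt < real i * dt" "real i * dt \<le> (real k + real \<tau>) * dt"
      by (simp_all add: algebra_simps)
    then have "real k < real i" "real i \<le> real k + real \<tau>"
      using \<open>0 < dt\<close> by (auto simp only: mult_less_cancel_right_pos mult_le_cancel_right_pos)
    then show False
      using assms(2) by linarith
  qed
  then have "raw_gamma dt \<tau> a b (real i * dt - real k * dt) = 0" for a b
    unfolding raw_gamma_def by (rule if_not_P)
  then show ?thesis
    by (simp add: dictionary_def gamma_shape_def)
qed

text \<open>Row 1 is the first row where block 0 can be nonzero, because the shape vanishes at time
  0. The raw sample at \<open>dt\<close> also makes the normalizing sum positive.\<close>

lemma dictionary_pos:
  assumes "0 < dt" "1 < N" "1 \<le> \<tau>"
  shows "0 < dictionary N dt \<tau> \<theta>1 \<theta>2 0 s 1"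
proof -
  have pos: "0 < raw_gamma dt \<tau> a b dt" for a b
    using assms by (simp add: raw_gamma_def)
  have "0 < (\<Sum>i<N. (raw_gamma dt \<tau> a b (real i * dt))\<^sup>2)" for a b
    using \<open>1 < N\<close> by (intro sum_pos2[where i = 1]) (simp_all add: less_imp_neq[OF pos, THEN not_sym])
  then show ?thesis
    unfolding dictionary_def gamma_shape_def using \<open>1 < N\<close>
    by (intro mult_pos_pos real_sqrt_gt_zero divide_pos_pos) (simp_all add: pos)
qed

lemma gram_commute: "gram N A k j s s' = gram N A j k s' s"
  by (simp add: gram_def mult.commute)

lemma mem_corr_nbhd_iff:
  assumes "1 \<le> p"
  shows "j \<in> corr_nbhd N p A \<rho> k \<longleftrightarrow> j < N \<and> (\<exists>s<p. \<exists>s'<p. \<rho> \<le> \<bar>gram N A k j s s'\<bar>)"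
proof -
  let ?G = "(\<lambda>(s, s'). \<bar>gram N A k j s s'\<bar>) ` ({..<p} \<times> {..<p})"
  have "finite ?G" "?G \<noteq> {}"
    using assms by (auto simp: lessThan_empty_iff)
  then have "\<rho> \<le> Max ?G \<longleftrightarrow> (\<exists>x\<in>?G. \<rho> \<le> x)"
    by (rule Max_ge_iff)
  also have "\<dots> \<longleftrightarrow> (\<exists>s<p. \<exists>s'<p. \<rho> \<le> \<bar>gram N A k j s s'\<bar>)"
    by auto
  finally show ?thesis
    by (auto simp: corr_nbhd_def not_less)
qed

lemma corr_nbhd_commute:
  assumes "1 \<le> p" "k < N"
  shows "j \<in> corr_nbhd N p A \<rho> k \<Longrightarrow> k \<in> corr_nbhd N p A \<rho> j"
  using assms gram_commute[of N A] by (metis mem_corr_nbhd_iff)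

lemma dictionary_gram_nonneg: "0 \<le> gram N (dictionary N dt \<tau> \<theta>1 \<theta>2) k j s s'"
  unfolding gram_def by (intro mult_nonneg_nonneg sum_nonneg dictionary_nonneg) simp

text \<open>The end of the window can only cut off non-negative terms.\<close>

lemma dictionary_gram_le:
  fixes \<theta>1 \<theta>2 :: "nat \<Rightarrow> real"
  assumes "0 < dt" "k0 + \<tau> < N"
  defines "A \<equiv> dictionary N dt \<tau> \<theta>1 \<theta>2"
  shows "gram N A k (k + d) s s' \<le> gram N A k0 (k0 + d) s s'"
proof -
  define w where "w n = A 0 s n * A d s' n" for n
  have w_nonneg: "0 \<le> w n" for n
    by (simp add: w_def A_def dictionary_nonneg)
  have w_0: "w n = 0" if "\<tau> < n" for n
    using that dictionary_eq_0[OF \<open>0 < dt\<close>, of n 0] by (simp add: w_def A_def)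
  have sum_w: "(\<Sum>i<N. A k s i * A (k + d) s' i) = (\<Sum>n<N - k. w n)" for k
  proof -
    have "(\<Sum>i<N. A k s i * A (k + d) s' i) = (\<Sum>i\<in>{k..<N}. A k s i * A (k + d) s' i)"
      by (rule sum.mono_neutral_right) (auto simp: A_def dictionary_eq_0[OF \<open>0 < dt\<close>])
    also have "\<dots> = (\<Sum>n<N - k. A k s (k + n) * A (k + d) s' (k + n))"
      by (rule sum.reindex_bij_witness[of _ "\<lambda>n. k + n" "\<lambda>i. i - k"]) auto
    also have "\<dots> = (\<Sum>n<N - k. w n)"
      using dictionary_shift[of N dt \<tau> \<theta>1 \<theta>2 k 0]
      by (auto intro!: sum.cong simp: w_def A_def dictionary_shift)
    finally show ?thesis .
  qed
  \<comment> \<open>Only terms up to \<open>\<tau>\<close> count, and the reference block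
    \<open>k0\<close> sees all of them since \<open>k0 + \<tau> < N\<close>.\<close>
  have "(\<Sum>n<N - k. w n) = (\<Sum>n\<in>{..<N - k} \<inter> {..\<tau>}. w n)"
    by (rule sum.mono_neutral_right) (auto intro: w_0)
  also have "\<dots> \<le> (\<Sum>n<N - k0. w n)"
    using assms(2) w_nonneg by (intro sum_mono2) auto
  finally show ?thesis
    by (simp add: gram_def sum_w divide_right_mono)
qed

text \<open>Uniqueness of the radius excludes the degenerate cases: empty interior, negative radius,
  level 0. After that, a correlation at lag \<open>d\<close> anywhere in the window is dominated by
  the one between blocks \<open>\<tau>\<close> and \<open>\<tau> + d\<close>, and block
  \<open>\<tau>\<close> lies in the interior, where the radius describes the neighborhood
  exactly.\<close>

lemma corr_nbhd_subset_nbhd: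
  fixes N :: nat and \<theta>1 \<theta>2 :: "nat \<Rightarrow> real"
  assumes "0 < dt" "1 \<le> p" "1 \<le> \<tau>" "0 \<le> \<rho>"
  defines "A \<equiv> dictionary N dt \<tau> \<theta>1 \<theta>2"
  assumes radius: "is_corr_radius N p \<tau> A \<rho> a"
  shows "0 \<le> a" and "k < N \<Longrightarrow> corr_nbhd N p A \<rho> k \<subseteq> nbhd N (real_of_int a) (real k)"
proof -
  let ?agree = "\<lambda>a'::int. \<forall>k. \<tau> \<le> k \<and> k + \<tau> \<le> N - 1 \<longrightarrow>
                  nbhd N (real_of_int a') (real k) = corr_nbhd N p A \<rho> k"
  have unique: "?agree a' \<longleftrightarrow> a' = a" for a'
    using radius unfolding is_corr_radius_def by blast
  \<comment> \<open>With an empty interior every integer would agree vacuously.\<close>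
  have window: "\<tau> + \<tau> \<le> N - 1"
  proof (rule ccontr)
    assume "\<not> \<tau> + \<tau> \<le> N - 1"
    then have "?agree (a + 1)" by auto
    then show False using unique[of "a + 1"] by simp
  qed
  \<comment> \<open>Negative radii all give empty neighborhoods, so none of them can be the only one
    that agrees.\<close>
  show "0 \<le> a"
  proof (rule ccontr)
    assume "\<not> 0 \<le> a"
    then have "nbhd N (real_of_int (a - 1)) x = nbhd N (real_of_int a) x" for x
      by (auto simp: nbhd_def)
    then have "?agree (a - 1)" using unique[of a] by simp
    then show False using unique[of "a - 1"] by simp
  qed
  \<comment> \<open>At level 0 every neighborhood is the whole window, and a larger radius would
    agree as well.\<close>
  have "0 < \<rho>"
  proof (rule ccontr)
    assume "\<not> 0 < \<rho>"
    with \<open>0 \<le> \<rho>\<close> have "\<rho> = 0" by simp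
    with \<open>1 \<le> p\<close> have all: "corr_nbhd N p A \<rho> k = {..<N}" for k
      by (auto simp: mem_corr_nbhd_iff intro!: exI[of _ 0])
    have "nbhd N (real_of_int a) x \<subseteq> nbhd N (real_of_int (a + 1)) x" for x
      by (auto simp: nbhd_def)
    moreover have "nbhd N (real_of_int (a + 1)) x \<subseteq> {..<N}" for x
      by (auto simp: nbhd_def)
    ultimately have "?agree (a + 1)"
      using unique[of a] unfolding all by blast
    then show False using unique[of "a + 1"] by simp
  qed
  have dist_le: "real j \<le> real k + real_of_int a" if j_near: "j \<in> corr_nbhd N p A \<rho> k" and "k \<le> j" for j k
  proof -
    obtain d where j: "j = k + d"
      using \<open>k \<le> j\<close> le_Suc_ex by blast
    obtain s s' where s: "s < p" "s' < p" "\<rho> \<le> gram N A k (k + d) s s'"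
      using j_near \<open>1 \<le> p\<close>
      unfolding j A_def by (auto simp: mem_corr_nbhd_iff abs_of_nonneg[OF dictionary_gram_nonneg])
    \<comment> \<open>Otherwise the two columns have disjoint supports and correlation 0. The bound
      also keeps block \<open>\<tau> + d\<close> inside the window.\<close>
    have "d < \<tau>"
    proof (rule ccontr)
      assume "\<not> d < \<tau>"
      then have "A k s i * A (k + d) s' i = 0" for i
        using dictionary_eq_0[OF \<open>0 < dt\<close>, of i k \<tau>] dictionary_eq_0[OF \<open>0 < dt\<close>, of i "k + d" \<tau>]
        unfolding A_def by (cases "i \<le> k + d") (auto simp: not_le)
      with s \<open>0 < \<rho>\<close> show False by (simp add: gram_def)
    qed
    have "\<rho> \<le> gram N A \<tau> (\<tau> + d) s s'"
    proof -
      have "gram N A k (k + d) s s' \<le> gram N A \<tau> (\<tau> + d) s s'"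
        unfolding A_def using window \<open>1 \<le> \<tau>\<close> by (intro dictionary_gram_le[OF \<open>0 < dt\<close>]) simp
      with s show ?thesis by simp
    qed
    then have "\<tau> + d \<in> corr_nbhd N p A \<rho> \<tau>"
      using s window \<open>d < \<tau>\<close> \<open>1 \<le> p\<close>
      unfolding A_def by (auto simp: mem_corr_nbhd_iff abs_of_nonneg[OF dictionary_gram_nonneg])
    also have "corr_nbhd N p A \<rho> \<tau> = nbhd N (real_of_int a) (real \<tau>)"
      using unique[of a] window by simp
    finally show ?thesis
      by (simp add: nbhd_def j)
  qed
  show "corr_nbhd N p A \<rho> k \<subseteq> nbhd N (real_of_int a) (real k)" if "k < N"
  proof
    fix j assume j: "j \<in> corr_nbhd N p A \<rho> k"
    \<comment> \<open>Symmetry reduces indices \<open>j\<close> to the left of \<open>k\<close> to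
      the one-sided estimate \<open>dist_le\<close>.\<close>
    then have k: "k \<in> corr_nbhd N p A \<rho> j"
      using corr_nbhd_commute \<open>1 \<le> p\<close> \<open>k < N\<close> by blast
    have "j < N" using j by (simp add: corr_nbhd_def)
    then show "j \<in> nbhd N (real_of_int a) (real k)"
      using dist_le[OF j] dist_le[OF k] \<open>0 \<le> a\<close> by (cases "k \<le> j") (auto simp: nbhd_def)
  qed
qed

section \<open>Deterministic rate bound\<close>

text \<open>A neighborhood that meets a maximal interval lies inside it, so each maximal interval
  contains a point of \<open>P0\<close>. Maximal intervals are pairwise disjoint, so these points
  are distinct.\<close>

lemma num_intervals_le:
  assumes U: "U = (\<Union>k\<in>K. nbhd N a (real k))" and "finite P0"
    and meets: "\<And>k. k \<in> K \<Longrightarrow> P0 \<inter> nbhd N a (real k) \<noteq> {}"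
  shows "num_intervals U \<le> card P0"
proof -
  define \<D> where "\<D> = {D. (\<exists>a b. a \<le> b \<and> D = {a..b}) \<and> D \<subseteq> U \<and>
              (\<forall>a b. D \<subseteq> {a..b} \<and> {a..b} \<subseteq> U \<longrightarrow> {a..b} = D)}"
  have \<D>: "(\<exists>a b. a \<le> b \<and> D = {a..b}) \<and> D \<subseteq> U \<and>
              (\<forall>a b. D \<subseteq> {a..b} \<and> {a..b} \<subseteq> U \<longrightarrow> {a..b} = D)" if "D \<in> \<D>" for D
    using that unfolding \<D>_def by (rule CollectD)
  have absorb: "{l..h} \<subseteq> D" if D: "D \<in> \<D>" and meet: "{l..h} \<inter> D \<noteq> {}" and sub: "{l..h} \<subseteq> U" for D and l h :: nat
  proof -
    obtain a b where ab: "D = {a..b}"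
      using \<D>[OF D] by blast
    have "D \<subseteq> U"
      using \<D>[OF D] by (elim conjE)
    \<comment> \<open>Two intersecting intervals have an interval as union; maximality of
      \<open>D\<close> then forbids enlarging it.\<close>
    have "{min a l..max b h} = {a..b} \<union> {l..h}"
    proof (rule set_eqI)
      fix x
      obtain u where "u \<in> {l..h}" "u \<in> {a..b}"
        using meet ab by blast
      then show "x \<in> {min a l..max b h} \<longleftrightarrow> x \<in> {a..b} \<union> {l..h}"
        by (cases "x \<le> u") (auto simp: min_le_iff_disj le_max_iff_disj)
    qed
    then have "{min a l..max b h} = D"
      using \<D>[OF D] \<open>D \<subseteq> U\<close> sub unfolding ab by (metis Un_least Un_upper1)
    then show ?thesis
      using \<open>{min a l..max b h} = {a..b} \<union> {l..h}\<close> by blast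
  qed
  have "\<exists>x. x \<in> P0 \<inter> D" if D: "D \<in> \<D>" for D
  proof -
    obtain u where "u \<in> D" "u \<in> U"
      using \<D>[OF D] by fastforce
    then obtain k where k: "k \<in> K" "u \<in> nbhd N a (real k)"
      using U by blast
    have "\<exists>l h. nbhd N a (real k) = {l..h}"
    proof -
      let ?V = "nbhd N a (real k)"
      have fin: "finite ?V" "?V \<noteq> {}"
        using k by (auto simp: nbhd_def)
      have "{Min ?V..Max ?V} \<subseteq> ?V"
        using Min_in[OF fin] Max_in[OF fin] by (auto simp: nbhd_def)
      then have "?V = {Min ?V..Max ?V}"
        using fin by auto
      then show ?thesis by blast
    qed
    then have "nbhd N a (real k) \<subseteq> D"
      using absorb[OF D] k \<open>u \<in> D\<close> U by (metis UN_upper disjoint_iff)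
    then show ?thesis
      using meets[OF k(1)] by blast
  qed
  then obtain f where f: "\<And>D. D \<in> \<D> \<Longrightarrow> f D \<in> P0 \<inter> D"
    by metis
  have "inj_on f \<D>"
  proof (rule inj_onI)
    fix D D' assume *: "D \<in> \<D>" "D' \<in> \<D>" "f D = f D'"
    then have "D \<inter> D' \<noteq> {}" using f by (metis disjoint_iff IntD2)
    moreover obtain a b c d where "D = {a..b}" "D' = {c..d}" "D \<subseteq> U" "D' \<subseteq> U"
      using \<D>[OF *(1)] \<D>[OF *(2)] by (elim conjE exE)
    ultimately show "D = D'"
      using absorb[OF *(1), of c d] absorb[OF *(2), of a b] by blast
  qed
  then have "card \<D> \<le> card P0"
    using f \<open>finite P0\<close> by (intro card_inj_on_le[of f]) auto
  then show ?thesis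
    by (simp add: num_intervals_def \<D>_def)
qed

lemma block_support_threshold:
  assumes "0 \<le> \<eta>"
  shows "block_support N p (threshold p \<eta> b) = {k. k < N \<and> \<eta> < block_norm1 p (b k)}"
proof -
  have "\<exists>s<p. c s \<noteq> 0" if "\<eta> < block_norm1 p c" for c
  proof (rule ccontr)
    assume "\<not> (\<exists>s<p. c s \<noteq> 0)"
    then have "block_norm1 p c = 0" by (simp add: block_norm1_def)
    with that assms show False by simp
  qed
  then show ?thesis
    by (auto simp: block_support_def threshold_def)
qed

lemma rate_opt_nonneg: "0 < dt \<Longrightarrow> 0 \<le> rate_opt dt P0"
  by (simp add: rate_opt_def divide_ereal_def ereal_inverse_nonneg_iff)

text \<open>The right-hand side simplifies to the estimated rate minus an interval count divided by
  \<open>dt * (a\<rho> + Max X)\<close>. The count is at most \<open>card P0\<close> and the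
  denominator at least \<open>dt * Max P0\<close>, so the quotient is at most
  \<open>rate_opt\<close>.\<close>

lemma rate_bound:
  fixes a\<rho> a\<mu> :: int
  assumes "0 < dt" "finite P0" "0 \<le> a\<rho>"
    and supp: "X = block_support N p b"
    and last: "P0 \<noteq> {} \<Longrightarrow> \<exists>m\<in>X. real (Max P0) \<le> real_of_int a\<rho> + real m"
    and meets: "\<And>k. k \<in> X \<Longrightarrow> P0 \<inter> nbhd N (real_of_int a\<mu>) (real k) \<noteq> {}"
  shows "let Mh = num_arrivals_est N p b; Th = arrival_est N p dt b; lh = rate_est N p dt b
        in ereal lh - rate_opt dt P0 \<le>
           ereal (lh * (1 - (Th Mh / dt) / (real_of_int a\<rho> + real (Max X))
                          * (real (num_intervals (\<Union>j\<in>{1..Mh}. nbhd N (real_of_int a\<mu>) (Th j / dt)))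
                             / real Mh)))"
proof (cases "onsets N p b = {}")
  \<comment> \<open>Without onsets the estimated rate is 0, whatever the last arrival time evaluates
    to, and nonnegativity of \<open>rate_opt\<close> suffices.\<close>
  case True
  then show ?thesis
    using rate_opt_nonneg[OF \<open>0 < dt\<close>, of P0]
    by (simp add: Let_def num_arrivals_est_def rate_est_def zero_ereal_def[symmetric])
next
  case False
  define K where "K = onsets N p b"
  define l where "l = sorted_list_of_set K"
  define Mh where "Mh = card K"
  have "finite X" "finite K" "K \<subseteq> X" "K \<noteq> {}"
    using False by (auto simp: supp K_def onsets_def block_support_def)
  have "0 < Mh"
    using \<open>finite K\<close> \<open>K \<noteq> {}\<close> by (simp add: Mh_def card_gt_0_iff)
  have l: "set l = K" "length l = Mh"
    using \<open>finite K\<close> by (simp_all add: l_def Mh_def)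
  have Th: "arrival_est N p dt b j / dt = real (l ! (j - 1))" for j
    using \<open>0 < dt\<close> by (simp add: arrival_est_def l_def K_def)
  have nth: "(\<lambda>j. l ! (j - 1)) ` {1..Mh} = K"
  proof -
    have "(\<lambda>j. l ! (j - 1)) ` {1..Mh} = (\<lambda>j. l ! j) ` {..<Mh}"
      unfolding image_Suc_lessThan[symmetric] image_image by simp
    also have "\<dots> = set l"
      by (auto simp: set_conv_nth l(2))
    finally show ?thesis by (simp add: l(1))
  qed
  define U where "U = (\<Union>j\<in>{1..Mh}. nbhd N (real_of_int a\<mu>) (arrival_est N p dt b j / dt))"
  have "U = (\<Union>k\<in>K. nbhd N (real_of_int a\<mu>) (real k))"
    unfolding U_def Th nth[symmetric] by simp
  then have I: "num_intervals U \<le> card P0"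
    using \<open>finite P0\<close> \<open>K \<subseteq> X\<close> meets by (intro num_intervals_le) auto
  define \<kappa> where "\<kappa> = l ! (Mh - 1)"
  have "\<kappa> \<in> K"
    using \<open>0 < Mh\<close> l by (metis \<kappa>_def diff_less nth_mem zero_less_one)
  \<comment> \<open>Onsets start at index 1, so the last estimated time and \<open>R\<close> are
    positive and the divisions are genuine.\<close>
  then have "1 \<le> \<kappa>" "\<kappa> \<le> Max X"
    using \<open>K \<subseteq> X\<close> \<open>finite X\<close> by (auto simp: K_def onsets_def)
  define R where "R = real_of_int a\<rho> + real (Max X)"
  have "0 < R"
    using \<open>1 \<le> \<kappa>\<close> \<open>\<kappa> \<le> Max X\<close> \<open>0 \<le> a\<rho>\<close> by (simp add: R_def)
  have "P0 \<noteq> {}"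
    using meets \<open>K \<subseteq> X\<close> \<open>\<kappa> \<in> K\<close> by blast
  then obtain m where "m \<in> X" "real (Max P0) \<le> real_of_int a\<rho> + real m"
    using last by blast
  then have max: "real (Max P0) \<le> R"
    using Max_ge[OF \<open>finite X\<close> \<open>m \<in> X\<close>] by (simp add: R_def)
  define lh where "lh = rate_est N p dt b"
  have lh: "lh = real Mh / (real \<kappa> * dt)"
    by (simp add: lh_def rate_est_def num_arrivals_est_def arrival_est_def \<kappa>_def l_def K_def Mh_def)
  have rhs: "lh * (1 - real \<kappa> / R * (real (num_intervals U) / real Mh)) = lh - real (num_intervals U) / (dt * R)"
    using \<open>0 < Mh\<close> \<open>1 \<le> \<kappa>\<close> \<open>0 < dt\<close> \<open>0 < R\<close> by (simp add: lh field_simps)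
  have "ereal (real (num_intervals U) / (dt * R)) \<le> rate_opt dt P0"
  \<comment> \<open>If all arrivals fall into bin 0, the optimal rate is infinite.\<close>
  proof (cases "Max P0 = 0")
    case True
    then have "rate_opt dt P0 = \<infinity>"
      using \<open>P0 \<noteq> {}\<close> \<open>finite P0\<close> by (simp add: rate_opt_def divide_ereal_def card_gt_0_iff)
    then show ?thesis by simp
  next
    case False
    then have "rate_opt dt P0 = ereal (real (card P0) / (dt * real (Max P0)))"
      using \<open>0 < dt\<close> by (simp add: rate_opt_def)
    moreover have "real (num_intervals U) / (dt * R) \<le> real (card P0) / (dt * real (Max P0))"
      using I max False \<open>0 < dt\<close> by (intro frac_le) auto
    ultimately show ?thesis by simp
  qed
  then have "ereal lh - rate_opt dt P0 \<le> ereal lh - ereal (real (num_intervals U) / (dt * R))"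
    by (intro ereal_minus_mono) auto
  then have "ereal lh - rate_opt dt P0 \<le>
      ereal (lh * (1 - real \<kappa> / R * (real (num_intervals U) / real Mh)))"
    by (simp only: rhs ereal_minus(1))
  moreover have "arrival_est N p dt b Mh / dt = real \<kappa>"
    by (simp add: Th \<kappa>_def)
  ultimately show ?thesis
    by (simp only: Let_def num_arrivals_est_def K_def[symmetric] Mh_def[symmetric] U_def[symmetric]
        R_def[symmetric] lh_def[symmetric])
qed

section \<open>Optimality conditions of the non-negative LASSO\<close>

text \<open>Elimination of one index \<open>x\<close>. Solving on \<open>I\<close> gives a vector
  \<open>w\<close> with \<open>w x = 1\<close> that \<open>K\<close> annihilates in the rows of
  \<open>I\<close>; the entry \<open>D\<close> of its image in row \<open>x\<close> equals the
  quadratic form at \<open>w\<close> and is therefore nonzero.\<close>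

lemma definite_solvable:
  fixes K :: "'i \<Rightarrow> 'i \<Rightarrow> real"
  assumes "finite I"
    and "\<And>c. (\<Sum>i\<in>I. \<Sum>j\<in>I. c i * K i j * c j) = 0 \<Longrightarrow> \<forall>i\<in>I. c i = 0"
  shows "\<exists>c. \<forall>i\<in>I. (\<Sum>j\<in>I. K i j * c j) = u i"
  using assms
proof (induction I arbitrary: u rule: finite_induct)
  case empty
  then show ?case by simp
next
  case (insert x I)
  have def_I: "\<forall>i\<in>I. c i = 0" if c: "(\<Sum>i\<in>I. \<Sum>j\<in>I. c i * K i j * c j) = 0" for c
  proof -
    let ?c = "\<lambda>i. if i = x then 0 else c i"
    have "(\<Sum>i\<in>insert x I. \<Sum>j\<in>insert x I. ?c i * K i j * ?c j) = (\<Sum>i\<in>I. \<Sum>j\<in>I. ?c i * K i j * ?c j)"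
      using insert.hyps by simp
    also have "\<dots> = (\<Sum>i\<in>I. \<Sum>j\<in>I. c i * K i j * c j)"
      using insert.hyps by (intro sum.cong refl) auto
    finally have "(\<Sum>i\<in>insert x I. \<Sum>j\<in>insert x I. ?c i * K i j * ?c j) = (\<Sum>i\<in>I. \<Sum>j\<in>I. c i * K i j * c j)" .
    with c have "\<forall>i\<in>insert x I. ?c i = 0"
      by (intro insert.prems) (simp only:)
    then show ?thesis
      using insert.hyps by (metis insertCI)
  qed
  obtain c0 where c0: "\<forall>i\<in>I. (\<Sum>j\<in>I. K i j * c0 j) = K i x"
    using insert.IH[of "\<lambda>i. K i x", OF def_I] by blast
  define w where "w j = (if j = x then 1 else - c0 j)" for j
  have w: "(\<Sum>j\<in>insert x I. K i j * w j) = K i x - (\<Sum>j\<in>I. K i j * c0 j)" for i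
    using insert.hyps by (auto simp: w_def sum_negf[symmetric] intro!: sum.cong)
  define D where "D = (\<Sum>j\<in>insert x I. K x j * w j)"
  have "(\<Sum>i\<in>insert x I. \<Sum>j\<in>insert x I. w i * K i j * w j)
      = (\<Sum>i\<in>insert x I. w i * (\<Sum>j\<in>insert x I. K i j * w j))"
    by (simp only: sum_distrib_left mult.assoc)
  also have "\<dots> = D + (\<Sum>i\<in>I. w i * (\<Sum>j\<in>insert x I. K i j * w j))"
    unfolding D_def using insert.hyps by (subst sum.insert) (auto simp: w_def)
  also have "\<dots> = D"
    using c0 by (simp add: w)
  finally have "D \<noteq> 0"
    using insert.prems[of w] by (auto simp: w_def)
  obtain c1 where c1: "\<forall>i\<in>I. (\<Sum>j\<in>I. K i j * c1 j) = u i"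
    using insert.IH[of u, OF def_I] by blast
  \<comment> \<open>Adding \<open>t * w\<close> to the solution \<open>c1\<close> on
    \<open>I\<close> leaves the rows of \<open>I\<close> unchanged and corrects row
    \<open>x\<close>.\<close>
  define t where "t = (u x - (\<Sum>j\<in>I. K x j * c1 j)) / D"
  define c where "c j = (if j = x then 0 else c1 j) + t * w j" for j
  have "(\<Sum>j\<in>insert x I. K i j * c j)
      = (\<Sum>j\<in>insert x I. K i j * (if j = x then 0 else c1 j)) + t * (\<Sum>j\<in>insert x I. K i j * w j)" for i
    by (simp only: c_def sum_distrib_left sum.distrib[symmetric]) (auto intro!: sum.cong simp: algebra_simps)
  moreover have "(\<Sum>j\<in>insert x I. K i j * (if j = x then 0 else c1 j)) = (\<Sum>j\<in>I. K i j * c1 j)" for i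
    using insert.hyps by (auto intro!: sum.cong)
  ultimately have c: "(\<Sum>j\<in>insert x I. K i j * c j)
      = (\<Sum>j\<in>I. K i j * c1 j) + t * (\<Sum>j\<in>insert x I. K i j * w j)" for i
    by simp
  have "(\<Sum>j\<in>insert x I. K i j * c j) = u i" if "i \<in> insert x I" for i
  proof (cases "i = x")
    case True
    then show ?thesis
      using \<open>D \<noteq> 0\<close> c[of x] by (simp add: D_def[symmetric] t_def)
  next
    case False
    then show ?thesis
      using that c[of i] c0 c1 by (simp add: w)
  qed
  then show ?case by blast
qed

text \<open>The directional derivative of the objective at \<open>b\<close> along \<open>d\<close>
  inside the nonnegative orthant, where the l1 norm is linear.\<close>

definition lasso_slope ::
  "nat \<Rightarrow> nat \<Rightarrow> (nat \<Rightarrow> nat \<Rightarrow> nat \<Rightarrow> real) \<Rightarrow> (nat \<Rightarrow> real) \<Rightarrow> real \<Rightarrow> (nat \<Rightarrow> nat \<Rightarrow> real) \<Rightarrow> (nat \<Rightarrow> nat \<Rightarrow> real) \<Rightarrow> real" where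
  "lasso_slope N p A y r b d =
     r * (\<Sum>k<N. \<Sum>s<p. d k s)
     - (\<Sum>i<N. (y i - dict_apply N p A b i) * dict_apply N p A d i) / real N"

lemma dict_apply_add:
  "dict_apply N p A (\<lambda>k s. b k s + t * d k s) i = dict_apply N p A b i + t * dict_apply N p A d i"
  by (simp add: dict_apply_def block_apply_def sum_distrib_left sum.distrib algebra_simps)

lemma lasso_objective_line:
  assumes "0 < N" "\<forall>k<N. \<forall>s<p. 0 \<le> b k s" "\<forall>k<N. \<forall>s<p. 0 \<le> b k s + t * d k s"
  shows "lasso_objective N p A y r (\<lambda>k s. b k s + t * d k s) =
    lasso_objective N p A y r b + t * lasso_slope N p A y r b d
      + t\<^sup>2 * ((\<Sum>i<N. (dict_apply N p A d i)\<^sup>2) / (2 * real N))"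
proof -
  have sq: "(L2_set f {..<N})\<^sup>2 = (\<Sum>i<N. (f i)\<^sup>2)" for f :: "nat \<Rightarrow> real"
    by (simp add: L2_set_def sum_nonneg)
  have norm: "(\<Sum>k<N. block_norm1 p (c k)) = (\<Sum>k<N. \<Sum>s<p. c k s)"
    if "\<forall>k<N. \<forall>s<p. 0 \<le> c k s" for c
    using that by (auto simp: block_norm1_def intro!: sum.cong)
  let ?w = "\<lambda>i. y i - dict_apply N p A b i" and ?z = "dict_apply N p A d"
  have "(\<Sum>i<N. (y i - dict_apply N p A (\<lambda>k s. b k s + t * d k s) i)\<^sup>2)
      = (\<Sum>i<N. (?w i)\<^sup>2 - 2 * t * (?w i * ?z i) + t\<^sup>2 * (?z i)\<^sup>2)"
    by (rule sum.cong) (simp_all add: dict_apply_add power2_eq_square algebra_simps)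
  also have "\<dots> = (\<Sum>i<N. (?w i)\<^sup>2) - 2 * t * (\<Sum>i<N. ?w i * ?z i) + t\<^sup>2 * (\<Sum>i<N. (?z i)\<^sup>2)"
    by (simp add: sum.distrib sum_subtractf sum_distrib_left)
  finally have fit: "(\<Sum>i<N. (y i - dict_apply N p A (\<lambda>k s. b k s + t * d k s) i)\<^sup>2) = \<dots>" .
  have "(\<Sum>k<N. \<Sum>s<p. b k s + t * d k s) = (\<Sum>k<N. \<Sum>s<p. b k s) + t * (\<Sum>k<N. \<Sum>s<p. d k s)"
    by (simp add: sum.distrib sum_distrib_left)
  then show ?thesis
    using \<open>0 < N\<close> unfolding lasso_objective_def lasso_slope_def sq fit norm[OF assms(2)] norm[OF assms(3)]
    by (simp add: field_simps)
qed

lemma lasso_objective_less_line: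
  assumes "is_nn_lasso N p A y r b" "0 < N" "t \<noteq> 0" "\<exists>k<N. \<exists>s<p. d k s \<noteq> 0"
    "\<forall>k<N. \<forall>s<p. 0 \<le> b k s + t * d k s"
  shows "0 < t * lasso_slope N p A y r b d + t\<^sup>2 * ((\<Sum>i<N. (dict_apply N p A d i)\<^sup>2) / (2 * real N))"
proof -
  have "lasso_objective N p A y r b < lasso_objective N p A y r (\<lambda>k s. b k s + t * d k s)"
    using assms unfolding is_nn_lasso_def by auto
  then show ?thesis
    using assms lasso_objective_line[OF \<open>0 < N\<close>, of p b t d A y r] unfolding is_nn_lasso_def by auto
qed

lemma line_slope_nonneg:
  fixes L q \<delta> :: real
  assumes "0 < \<delta>" "\<And>t. 0 < t \<Longrightarrow> t \<le> \<delta> \<Longrightarrow> 0 < t * L + t\<^sup>2 * q"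
  shows "0 \<le> L"
proof (rule ccontr)
  assume "\<not> 0 \<le> L"
  \<comment> \<open>Short enough for the decrease \<open>t * L\<close> to make up for
    \<open>t\<^sup>2 * q\<close>; the added 1 keeps the denominator positive when
    \<open>q = 0\<close>.\<close>
  define t where "t = min \<delta> (- L / (\<bar>q\<bar> + 1))"
  have "0 < t" "t \<le> \<delta>"
    using \<open>0 < \<delta>\<close> \<open>\<not> 0 \<le> L\<close> by (auto simp: t_def intro!: divide_neg_pos)
  have "t * q \<le> t * (\<bar>q\<bar> + 1)"
    using \<open>0 < t\<close> by (intro mult_left_mono) auto
  also have "\<dots> \<le> - L / (\<bar>q\<bar> + 1) * (\<bar>q\<bar> + 1)"
    by (intro mult_right_mono) (auto simp: t_def)
  also have "\<dots> = - L"
    by simp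
  finally have "t * (L + t * q) \<le> 0"
    using \<open>0 < t\<close> by (intro mult_nonneg_nonpos) auto
  then show False
    using assms(2)[OF \<open>0 < t\<close> \<open>t \<le> \<delta>\<close>] by (simp add: power2_eq_square algebra_simps)
qed

text \<open>A direction with nonnegative entries stays feasible for every positive step.\<close>

lemma nn_lasso_slope_nonneg:
  assumes lasso: "is_nn_lasso N p A y r b" and "0 < N"
    and d: "\<forall>k<N. \<forall>s<p. 0 \<le> d k s" "\<exists>k<N. \<exists>s<p. d k s \<noteq> 0"
  shows "0 \<le> lasso_slope N p A y r b d"
proof (rule line_slope_nonneg)
  show "0 < (1 :: real)" by simp
  fix t :: real assume "0 < t"
  then show "0 < t * lasso_slope N p A y r b d + t\<^sup>2 * ((\<Sum>i<N. (dict_apply N p A d i)\<^sup>2) / (2 * real N))"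
    using lasso d unfolding is_nn_lasso_def
    by (intro lasso_objective_less_line[OF lasso \<open>0 < N\<close>]) (auto intro!: add_nonneg_nonneg)
qed

text \<open>Along a direction supported on the active set both signs are feasible.\<close>

lemma nn_lasso_active_direction:
  assumes lasso: "is_nn_lasso N p A y r b" and "0 < N"
    and active: "\<And>k s. k < N \<Longrightarrow> s < p \<Longrightarrow> d k s \<noteq> 0 \<Longrightarrow> b k s \<noteq> 0"
    and d: "\<exists>k<N. \<exists>s<p. d k s \<noteq> 0"
  shows "lasso_slope N p A y r b d = 0"
    and "(\<Sum>i<N. (dict_apply N p A d i)\<^sup>2) \<noteq> 0"
proof -
  define R where "R = {(k, s). k < N \<and> s < p \<and> d k s \<noteq> 0}"
  \<comment> \<open>Steps of either sign and size at most \<open>\<delta>\<close> keep all entries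
    nonnegative; \<open>\<delta>\<close> is positive because \<open>d\<close> lives on the active
    set.\<close>
  define \<delta> where "\<delta> = Min ((\<lambda>(k, s). b k s / \<bar>d k s\<bar>) ` R)"
  have fin: "finite R" "R \<noteq> {}"
    using d by (auto simp: R_def intro: finite_subset[of _ "{..<N} \<times> {..<p}"])
  have b: "\<forall>k<N. \<forall>s<p. 0 \<le> b k s"
    using lasso by (simp add: is_nn_lasso_def)
  have "0 < b k s / \<bar>d k s\<bar>" if "(k, s) \<in> R" for k s
    using that active[of k s] b by (auto simp: R_def less_le)
  then have "0 < \<delta>"
    using fin by (auto simp: \<delta>_def)
  have feasible: "0 \<le> b k s + t * d k s" if "\<bar>t\<bar> \<le> \<delta>" "k < N" "s < p" for t k s
  proof (cases "d k s = 0")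
    case False
    then have "\<delta> \<le> b k s / \<bar>d k s\<bar>"
      using fin that by (auto simp: \<delta>_def R_def intro!: Min_le)
    with that have "\<bar>t\<bar> * \<bar>d k s\<bar> \<le> b k s"
      using False by (metis order_trans pos_le_divide_eq zero_less_abs_iff)
    then show ?thesis by (simp add: abs_mult[symmetric] abs_le_iff)
  qed (use b that in auto)
  define q where "q = (\<Sum>i<N. (dict_apply N p A d i)\<^sup>2) / (2 * real N)"
  define L where "L = lasso_slope N p A y r b d"
  have pos: "0 < t * L + t\<^sup>2 * q" if "\<bar>t\<bar> \<le> \<delta>" "t \<noteq> 0" for t
    unfolding q_def L_def using that feasible
    by (intro lasso_objective_less_line[OF lasso \<open>0 < N\<close> _ d]) auto
  have "0 \<le> L"
    using \<open>0 < \<delta>\<close> pos by (intro line_slope_nonneg[of \<delta> _ q]) auto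
  moreover have "0 \<le> - L"
    using \<open>0 < \<delta>\<close> pos[of "- _"] by (intro line_slope_nonneg[of \<delta> _ q]) auto
  ultimately have "L = 0" by simp
  then show "lasso_slope N p A y r b d = 0"
    by (simp add: L_def)
  \<comment> \<open>With zero slope, strict minimality can only come from the quadratic
    term.\<close>
  show "(\<Sum>i<N. (dict_apply N p A d i)\<^sup>2) \<noteq> 0"
    using pos[of \<delta>] \<open>0 < \<delta>\<close> \<open>L = 0\<close> by (auto simp: q_def)
qed

text \<open>Flattening the double index lets the active set serve as the index set of a linear
  system.\<close>

lemma dict_apply_pairs:
  assumes "I \<subseteq> {..<N} \<times> {..<p}" "\<And>k s. k < N \<Longrightarrow> s < p \<Longrightarrow> (k, s) \<notin> I \<Longrightarrow> d k s = 0"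
  shows "dict_apply N p A d i = (\<Sum>x\<in>I. A (fst x) (snd x) i * d (fst x) (snd x))"
proof -
  have "dict_apply N p A d i = (\<Sum>x\<in>{..<N} \<times> {..<p}. A (fst x) (snd x) i * d (fst x) (snd x))"
    by (simp add: dict_apply_def block_apply_def sum.cartesian_product case_prod_beta)
  also have "\<dots> = (\<Sum>x\<in>I. A (fst x) (snd x) i * d (fst x) (snd x))"
    using assms by (intro sum.mono_neutral_right) auto
  finally show ?thesis .
qed

text \<open>
  On the active set \<open>I\<close> the Gram matrix is definite, so there is a \<open>v\<close> in the span of the active
  columns that has inner product 1 with those of block \<open>k\<close> and 0 with the others.  The stationarity
  condition tested with \<open>v\<close> then determines \<open>\<langle>v, y\<rangle>\<close> from the norm of block \<open>k\<close>.
\<close>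

lemma nn_lasso_block_norm_hyperplane:
  assumes "0 < N" "0 < \<eta>" "k < N"
  shows "\<exists>v c. (\<exists>i<N. v i \<noteq> 0) \<and>
    (\<forall>y b. is_nn_lasso N p A y r b \<longrightarrow> {(k, s). k < N \<and> s < p \<and> b k s \<noteq> 0} = I \<longrightarrow>
       block_norm1 p (b k) = \<eta> \<longrightarrow> (\<Sum>i<N. v i * y i) = c)"
proof (cases "\<exists>y b. is_nn_lasso N p A y r b \<and> {(k, s). k < N \<and> s < p \<and> b k s \<noteq> 0} = I \<and>
       block_norm1 p (b k) = \<eta>")
  case False
  show ?thesis
  \<comment> \<open>The implication is vacuous here, so any nonzero vector serves.\<close>
  proof (rule exI[of _ "\<lambda>_. 1"], rule exI[of _ 0], rule conjI)
    show "\<exists>i<N. (1 :: real) \<noteq> 0"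
      using \<open>0 < N\<close> by auto
  qed (use False in blast)
next
  case True
  then obtain y0 b0 where lasso0: "is_nn_lasso N p A y0 r b0"
    and I0: "{(k, s). k < N \<and> s < p \<and> b0 k s \<noteq> 0} = I" and norm0: "block_norm1 p (b0 k) = \<eta>"
    by blast
  have I: "I \<subseteq> {..<N} \<times> {..<p}" "finite I"
    using I0 by (auto intro: finite_subset[of _ "{..<N} \<times> {..<p}"])
  define a where "a x i = A (fst x) (snd x) i" for x i
  define K where "K x x' = (\<Sum>i<N. a x i * a x' i)" for x x'
  define dir where "dir c k s = (if (k, s) \<in> I then c (k, s) else 0)" for c :: "nat \<times> nat \<Rightarrow> real" and k s
  have apply_dir: "dict_apply N p A (dir c) i = (\<Sum>x\<in>I. a x i * c x)" for c i
    using I by (subst dict_apply_pairs[of I]) (auto simp: dir_def a_def intro!: sum.cong)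
  \<comment> \<open>The form of \<open>K\<close> is an inner product of fitted vectors, so
    definiteness reduces to \<open>nn_lasso_active_direction\<close>.\<close>
  have quad: "(\<Sum>x\<in>I. \<Sum>x'\<in>I. c x * K x x' * c' x') = (\<Sum>i<N. (\<Sum>x\<in>I. a x i * c x) * (\<Sum>x\<in>I. a x i * c' x))" for c c'
  proof -
    have "(\<Sum>x\<in>I. \<Sum>x'\<in>I. c x * K x x' * c' x') = (\<Sum>x\<in>I. \<Sum>x'\<in>I. \<Sum>i<N. (a x i * c x) * (a x' i * c' x'))"
      by (simp add: K_def sum_distrib_left sum_distrib_right algebra_simps)
    also have "\<dots> = (\<Sum>x\<in>I. \<Sum>i<N. \<Sum>x'\<in>I. (a x i * c x) * (a x' i * c' x'))"
      by (intro sum.cong sum.swap refl)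
    also have "\<dots> = (\<Sum>i<N. \<Sum>x\<in>I. \<Sum>x'\<in>I. (a x i * c x) * (a x' i * c' x'))"
      by (rule sum.swap)
    finally show ?thesis by (simp add: sum_product)
  qed
  have definite: "\<forall>x\<in>I. c x = 0" if "(\<Sum>x\<in>I. \<Sum>x'\<in>I. c x * K x x' * c x') = 0" for c
  proof (rule ccontr)
    assume "\<not> ?thesis"
    then have nz: "\<exists>k<N. \<exists>s<p. dir c k s \<noteq> 0"
      using I by (force simp: dir_def)
    have "(\<Sum>i<N. (dict_apply N p A (dir c) i)\<^sup>2) \<noteq> 0"
      by (rule nn_lasso_active_direction(2)[OF lasso0 \<open>0 < N\<close> _ nz])
        (use I0 in \<open>auto simp: dir_def split: if_splits\<close>)
    then show False
      using that by (simp add: apply_dir quad power2_eq_square)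
  qed
  obtain c where c: "\<forall>x\<in>I. (\<Sum>x'\<in>I. K x x' * c x') = (if fst x = k then 1 else 0)"
    using definite_solvable[OF \<open>finite I\<close> definite, where u = "\<lambda>x. if fst x = k then 1 else 0"] by blast
  \<comment> \<open>Since \<open>0 < \<eta>\<close>, block \<open>k\<close> has an active entry; the
    right-hand side 1 there prevents \<open>c\<close> from vanishing.\<close>
  have "\<exists>s<p. b0 k s \<noteq> 0"
    using norm0 \<open>0 < \<eta>\<close> unfolding block_norm1_def
    by (metis abs_zero less_irrefl sum.neutral lessThan_iff)
  then obtain s0 where s0: "(k, s0) \<in> I"
    using I0 \<open>k < N\<close> by auto
  define v where "v i = (\<Sum>x\<in>I. a x i * c x)" for i
  have "\<exists>x\<in>I. c x \<noteq> 0"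
    using c s0 by (metis (no_types, lifting) fst_conv mult_zero_right sum.neutral zero_neq_one)
  then have nz: "\<exists>k<N. \<exists>s<p. dir c k s \<noteq> 0"
    using I by (force simp: dir_def)
  have "(\<Sum>i<N. (v i)\<^sup>2) \<noteq> 0"
    unfolding v_def apply_dir[symmetric]
    by (rule nn_lasso_active_direction(2)[OF lasso0 \<open>0 < N\<close> _ nz])
      (use I0 in \<open>auto simp: dir_def split: if_splits\<close>)
  then have v: "\<exists>i<N. v i \<noteq> 0"
    by (auto intro: ccontr)
  have "(\<Sum>i<N. v i * y i) = \<eta> + real N * (r * (\<Sum>k<N. \<Sum>s<p. dir c k s))"
    if lasso: "is_nn_lasso N p A y r b" and Ib: "{(k, s). k < N \<and> s < p \<and> b k s \<noteq> 0} = I"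
      and norm: "block_norm1 p (b k) = \<eta>" for y b
  proof -
    have "lasso_slope N p A y r b (dir c) = 0"
      by (rule nn_lasso_active_direction(1)[OF lasso \<open>0 < N\<close> _ nz])
        (use Ib in \<open>auto simp: dir_def split: if_splits\<close>)
    then have slope: "(\<Sum>i<N. (y i - dict_apply N p A b i) * v i) = real N * (r * (\<Sum>k<N. \<Sum>s<p. dir c k s))"
      using \<open>0 < N\<close> by (simp add: lasso_slope_def apply_dir v_def field_simps)
    define b' where "b' x = b (fst x) (snd x)" for x
    have apply_b: "dict_apply N p A b i = (\<Sum>x\<in>I. a x i * b' x)" for i
      using I Ib by (subst dict_apply_pairs[of I]) (auto simp: a_def b'_def)
    \<comment> \<open>Pairing the fit with \<open>v\<close> picks out block \<open>k\<close> by the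
      choice of \<open>c\<close>, and nonnegativity turns its sum into its norm.\<close>
    have "(\<Sum>i<N. dict_apply N p A b i * v i) = (\<Sum>x\<in>I. \<Sum>x'\<in>I. b' x * K x x' * c x')"
      by (simp add: apply_b v_def quad)
    also have "\<dots> = (\<Sum>x\<in>I. b' x * (\<Sum>x'\<in>I. K x x' * c x'))"
      by (simp add: sum_distrib_left mult.assoc)
    also have "\<dots> = (\<Sum>x\<in>I. if fst x = k then b' x else 0)"
      using c by (intro sum.cong) auto
    also have "\<dots> = (\<Sum>x\<in>{..<N} \<times> {..<p}. if fst x = k then b' x else 0)"
      using I Ib by (intro sum.mono_neutral_left) (auto simp: b'_def)
    also have "\<dots> = (\<Sum>k'<N. \<Sum>s<p. if k' = k then b k' s else 0)"
      unfolding b'_def by (simp add: sum.cartesian_product case_prod_beta)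
    also have "\<dots> = (\<Sum>k'<N. if k' = k then (\<Sum>s<p. b k' s) else 0)"
      by (intro sum.cong) auto
    also have "\<dots> = (\<Sum>s<p. b k s)"
      using \<open>k < N\<close> by simp
    also have "\<dots> = block_norm1 p (b k)"
      using lasso \<open>k < N\<close> by (simp add: block_norm1_def is_nn_lasso_def)
    finally show ?thesis
      using slope norm by (simp add: right_diff_distrib sum_subtractf mult.commute)
  qed
  with v show ?thesis by blast
qed

text \<open>Small blocks bound the fit, so large samples leave large residuals. Increasing the first
  coefficient of block 0 would then lower the objective, against
  \<open>nn_lasso_slope_nonneg\<close>.\<close>

lemma nn_lasso_large_block:
  fixes \<theta>1 \<theta>2 :: "nat \<Rightarrow> real"
  assumes "0 < dt" "1 < N" "1 \<le> p" "1 \<le> \<tau>"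
  defines "A \<equiv> dictionary N dt \<tau> \<theta>1 \<theta>2"
  shows "\<exists>R. \<forall>y b. is_nn_lasso N p A y r b \<longrightarrow> (\<forall>i<N. R \<le> y i) \<longrightarrow> (\<exists>k<N. \<eta> \<le> block_norm1 p (b k))"
proof -
  define B where "B = (\<Sum>i<N. \<Sum>k<N. \<Sum>s<p. A k s i * \<bar>\<eta>\<bar>)"
  have A_nonneg: "0 \<le> A k s i" for k s i
    by (simp add: A_def dictionary_nonneg)
  have A_pos: "0 < A 0 0 1"
    using assms unfolding A_def by (intro dictionary_pos) auto
  \<comment> \<open>\<open>B\<close> bounds the fit when all blocks are small; the rest makes row 1
    alone outweigh the penalty \<open>r * N\<close>.\<close>
  define R where "R = B + (\<bar>r\<bar> + 1) * real N / A 0 0 1"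
  have "\<exists>k<N. \<eta> \<le> block_norm1 p (b k)"
    if lasso: "is_nn_lasso N p A y r b" and y: "\<forall>i<N. R \<le> y i" for y b
  proof (rule ccontr)
    assume small: "\<not> ?thesis"
    have "A k s i * b k s \<le> A k s i * \<bar>\<eta>\<bar>" if "k < N" "s < p" for k s i
    proof (rule mult_left_mono[OF _ A_nonneg])
      have "b k s \<le> \<bar>b k s\<bar>" by simp
      also have "\<dots> \<le> block_norm1 p (b k)"
        unfolding block_norm1_def using that by (intro member_le_sum) auto
      also have "\<dots> \<le> \<bar>\<eta>\<bar>"
        using small that by force
      finally show "b k s \<le> \<bar>\<eta>\<bar>" .
    qed
    then have "dict_apply N p A b i \<le> (\<Sum>k<N. \<Sum>s<p. A k s i * \<bar>\<eta>\<bar>)" for i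
      unfolding dict_apply_def block_apply_def by (intro sum_mono) auto
    moreover have "(\<Sum>k<N. \<Sum>s<p. A k s i * \<bar>\<eta>\<bar>) \<le> B" if "i < N" for i
      unfolding B_def using that A_nonneg by (intro member_le_sum) (auto intro!: sum_nonneg)
    ultimately have resid: "(\<bar>r\<bar> + 1) * real N / A 0 0 1 \<le> y i - dict_apply N p A b i" if "i < N" for i
      using y that unfolding R_def by (smt (verit, best))
    define d :: "nat \<Rightarrow> nat \<Rightarrow> real" where "d k s = (if k = 0 \<and> s = 0 then 1 else 0)" for k s
    have sum_d: "(\<Sum>k<N. \<Sum>s<p. f k s * d k s) = f 0 0" for f
    proof -
      have "(\<Sum>k<N. \<Sum>s<p. f k s * d k s) = (\<Sum>x\<in>{..<N} \<times> {..<p}. if x = (0, 0) then f 0 0 else 0)"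
        unfolding sum.cartesian_product by (rule sum.cong) (auto simp: d_def split: if_splits)
      also have "\<dots> = f 0 0"
        using assms by simp
      finally show ?thesis .
    qed
    have "dict_apply N p A d i = A 0 0 i" for i
      using sum_d[of "\<lambda>k s. A k s i"] by (simp add: dict_apply_def block_apply_def)
    moreover have "(\<Sum>k<N. \<Sum>s<p. d k s) = 1"
      using sum_d[of "\<lambda>_ _. 1"] by simp
    moreover have "0 \<le> lasso_slope N p A y r b d"
      using assms by (intro nn_lasso_slope_nonneg[OF lasso]) (auto simp: d_def intro!: exI[of _ 0])
    ultimately have "(\<Sum>i<N. (y i - dict_apply N p A b i) * A 0 0 i) \<le> r * real N"
      using \<open>1 < N\<close> by (simp add: lasso_slope_def field_simps)
    moreover have "(y 1 - dict_apply N p A b 1) * A 0 0 1 \<le> (\<Sum>i<N. (y i - dict_apply N p A b i) * A 0 0 i)"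
    proof (rule member_le_sum)
      fix i assume "i \<in> {..<N} - {1}"
      then have "0 \<le> y i - dict_apply N p A b i"
        by (intro order_trans[OF _ resid]) (use A_pos in auto)
      then show "0 \<le> (y i - dict_apply N p A b i) * A 0 0 i"
        using A_nonneg by simp
    qed (use \<open>1 < N\<close> in auto)
    moreover have "(\<bar>r\<bar> + 1) * real N \<le> (y 1 - dict_apply N p A b 1) * A 0 0 1"
      using resid[of 1] \<open>1 < N\<close> A_pos by (simp add: pos_divide_le_eq)
    moreover have "r * real N < (\<bar>r\<bar> + 1) * real N"
      using \<open>1 < N\<close> by (intro mult_strict_right_mono) auto
    ultimately show False by linarith
  qed
  then show ?thesis by blast
qed

section \<open>Gaussian noise\<close>

text \<open>The formula is odd in \<open>x\<close>, and its value at 0 is 0 because division by 0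
  yields 0.\<close>

lemma tail_nonpos: "x \<le> 0 \<Longrightarrow> tail x \<le> 0"
  by (auto simp: tail_def intro!: mult_nonpos_nonneg divide_nonneg_nonpos mult_nonpos_nonneg)

lemma tail_pos: "0 < x \<Longrightarrow> 0 < tail x"
  by (simp add: tail_def)

lemma norm0_eq_sum: "norm0 N p b = (\<Sum>k<N. block_norm0 p (b k))"
proof -
  have "{(k, s). k < N \<and> s < p \<and> b k s \<noteq> 0} = (SIGMA k:{..<N}. {s. s < p \<and> b k s \<noteq> 0})"
    by auto
  then show ?thesis
    by (simp add: norm0_def block_norm0_def)
qed

lemma block_norm0_eq_sum: "real (block_norm0 p c) = (\<Sum>s<p. if c s \<noteq> 0 then 1 else 0)"
proof -
  have "real (block_norm0 p c) = (\<Sum>s\<in>{s \<in> {..<p}. c s \<noteq> 0}. 1)"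
    by (simp add: block_norm0_def)
  also have "\<dots> = (\<Sum>s<p. if c s \<noteq> 0 then 1 else 0)"
    by (rule sum.inter_filter) simp
  finally show ?thesis .
qed

text \<open>\<open>R\<close> is arbitrary, but the superlevel set takes finitely many values, so the
  event is a finite union of events that fix this value.\<close>

lemma sets_Collect_superlevel:
  fixes f :: "'i \<Rightarrow> 'e \<Rightarrow> real"
  assumes "finite I" "\<And>k. k \<in> I \<Longrightarrow> f k \<in> borel_measurable Q"
  shows "{e \<in> space Q. R {k \<in> I. \<eta> < f k e}} \<in> sets Q"
proof -
  have "{e \<in> space Q. R {k \<in> I. \<eta> < f k e}} =
      (\<Union>X\<in>Pow I \<inter> Collect R. {e \<in> space Q. \<forall>k\<in>I. \<eta> < f k e \<longleftrightarrow> k \<in> X})"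
  proof (intro set_eqI iffI)
    fix e assume "e \<in> {e \<in> space Q. R {k \<in> I. \<eta> < f k e}}"
    then show "e \<in> (\<Union>X\<in>Pow I \<inter> Collect R. {e \<in> space Q. \<forall>k\<in>I. \<eta> < f k e \<longleftrightarrow> k \<in> X})"
      by (intro UN_I[of "{k \<in> I. \<eta> < f k e}"]) auto
  next
    fix e assume "e \<in> (\<Union>X\<in>Pow I \<inter> Collect R. {e \<in> space Q. \<forall>k\<in>I. \<eta> < f k e \<longleftrightarrow> k \<in> X})"
    then obtain X where "X \<subseteq> I" "R X" "e \<in> space Q" "\<forall>k\<in>I. \<eta> < f k e \<longleftrightarrow> k \<in> X"
      by auto
    moreover from this have "{k \<in> I. \<eta> < f k e} = X" by auto
    ultimately show "e \<in> {e \<in> space Q. R {k \<in> I. \<eta> < f k e}}" by simp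
  qed
  also have "\<dots> \<in> sets Q"
  proof (intro sets.finite_UN sets.sets_Collect_finite_All)
    fix X k assume "k \<in> I"
    from assms(2)[OF this] show "{e \<in> space Q. \<eta> < f k e \<longleftrightarrow> k \<in> X} \<in> sets Q"
      by measurable
  qed (use \<open>finite I\<close> in auto)
  finally show ?thesis .
qed

context prob_space
begin

lemma prob_gaussian_hyperplane:
  assumes noise: "gaussian_noise M N \<sigma> \<epsilon>" and "0 < \<sigma>" and "\<exists>i<N. v i \<noteq> 0"
  shows "AE e in M. (\<Sum>i<N. v i * \<epsilon> i e) \<noteq> c"
proof -
  \<comment> \<open>A scaled normal variable has a density only if the factor is nonzero.\<close>
  define I where "I = {i. i < N \<and> v i \<noteq> 0}"
  have I: "finite I" "I \<noteq> {}" "I \<subseteq> {..<N}"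
    using assms(3) by (auto simp: I_def)
  have "indep_vars (\<lambda>_. borel) \<epsilon> I"
    using noise I(3) by (auto simp: gaussian_noise_def intro: indep_vars_subset)
  then have indep: "indep_vars (\<lambda>_. borel) (\<lambda>i e. v i * \<epsilon> i e) I"
    by (rule indep_vars_compose2) simp
  have normal: "distributed M lborel (\<lambda>e. v i * \<epsilon> i e) (normal_density 0 (\<bar>v i\<bar> * \<sigma>))" if "i \<in> I" for i
    using normal_density_affine[of "\<epsilon> i" 0 \<sigma> "v i" 0] noise \<open>0 < \<sigma>\<close> that
    by (auto simp: gaussian_noise_def I_def)
  have "distributed M lborel (\<lambda>e. \<Sum>i\<in>I. v i * \<epsilon> i e)
      (normal_density (\<Sum>i\<in>I. 0) (sqrt (\<Sum>i\<in>I. (\<bar>v i\<bar> * \<sigma>)\<^sup>2)))"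
    using \<open>0 < \<sigma>\<close> by (intro sum_indep_normal I indep normal) (auto simp: I_def)
  then have dist: "distributed M lborel (\<lambda>e. \<Sum>i\<in>I. v i * \<epsilon> i e)
      (normal_density 0 (sqrt (\<Sum>i\<in>I. (\<bar>v i\<bar> * \<sigma>)\<^sup>2)))"
    by simp
  have "AE x in lborel. x \<noteq> c"
    by (rule AE_lborel_singleton)
  moreover have "Measurable.pred lborel (\<lambda>x::real. x \<noteq> c)"
    by simp
  ultimately have "AE e in M. (\<Sum>i\<in>I. v i * \<epsilon> i e) \<noteq> c"
    by (subst distributed_AE2[OF dist]) auto
  moreover have "(\<Sum>i\<in>I. v i * \<epsilon> i e) = (\<Sum>i<N. v i * \<epsilon> i e)" for e
    by (rule sum.mono_neutral_left) (auto simp: I_def)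
  ultimately show ?thesis by simp
qed

text \<open>Independence gives a product, and each factor is positive because the normal density
  vanishes nowhere and a half-line has positive Lebesgue measure.\<close>

lemma prob_gaussian_orthant_pos:
  assumes noise: "gaussian_noise M N \<sigma> \<epsilon>" and "0 < \<sigma>" "0 < N"
  shows "0 < prob {e \<in> space M. \<forall>i<N. R < \<epsilon> i e}"
proof -
  have indep: "indep_vars (\<lambda>_. borel) \<epsilon> {..<N}"
    and dist: "\<And>i. i < N \<Longrightarrow> distributed M lborel (\<epsilon> i) (normal_density 0 \<sigma>)"
    using noise by (simp_all add: gaussian_noise_def)
  have pos: "0 < prob (\<epsilon> i -` {R<..} \<inter> space M)" if "i < N" for i
  proof (rule ccontr)
    assume "\<not> ?thesis"
    then have "prob (\<epsilon> i -` {R<..} \<inter> space M) = 0"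
      using measure_nonneg[of M] by (metis less_le)
    then have "emeasure M (\<epsilon> i -` {R<..} \<inter> space M) = 0"
      by (simp add: emeasure_eq_measure)
    then have "(\<integral>\<^sup>+x. ennreal (normal_density 0 \<sigma> x) * indicator {R<..} x \<partial>lborel) = 0"
      using distributed_emeasure[OF dist[OF that], of "{R<..}"] by simp
    then have "AE x in lborel. ennreal (normal_density 0 \<sigma> x) * indicator {R<..} x = 0"
      by (subst (asm) nn_integral_0_iff_AE) auto
    moreover have "\<not> normal_density 0 \<sigma> x \<le> 0" for x
      by (simp add: not_le normal_density_pos[OF \<open>0 < \<sigma>\<close>])
    ultimately have "AE x in lborel. x \<notin> {R<..}"
      by (auto elim!: eventually_mono simp: indicator_def ennreal_eq_0_iff split: if_splits)
    then have "emeasure lborel {R<..} = 0"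
      by (subst (asm) AE_iff_measurable[OF _ refl]) (auto simp: greaterThan_def)
    moreover have "emeasure lborel {R<..<R + 1} \<le> emeasure lborel {R<..}"
      by (rule emeasure_mono) auto
    ultimately show False by simp
  qed
  have "{e \<in> space M. \<forall>i<N. R < \<epsilon> i e} = (\<Inter>i\<in>{..<N}. \<epsilon> i -` {R<..} \<inter> space M)"
    using \<open>0 < N\<close> by auto
  then have "prob {e \<in> space M. \<forall>i<N. R < \<epsilon> i e} = (\<Prod>i<N. prob (\<epsilon> i -` {R<..} \<inter> space M))"
    using indep_varsD_finite[OF indep, of "\<lambda>_. {R<..}"] \<open>0 < N\<close> by (auto simp: lessThan_empty_iff)
  also have "\<dots> > 0"
    using pos by (intro prod_pos) auto
  finally show ?thesis .
qed

text \<open>The active set depends on the noise, but only finitely many are possible. Each confines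
  the observations with a tie to one hyperplane, which Gaussian noise almost surely avoids.\<close>

lemma AE_block_norm_neq:
  assumes noise: "gaussian_noise M N \<sigma> \<epsilon>" "0 < \<sigma>" and "0 < N" "0 < \<eta>" "k < N"
    and lasso: "AE e in M. is_nn_lasso N p A (\<lambda>i. ybar i + \<epsilon> i e) r (b e)"
  shows "AE e in M. block_norm1 p (b e k) \<noteq> \<eta>"
proof -
  define P where "P I v c \<longleftrightarrow> (\<exists>i<N. v i \<noteq> 0) \<and>
    (\<forall>y b. is_nn_lasso N p A y r b \<longrightarrow> {(k, s). k < N \<and> s < p \<and> b k s \<noteq> 0} = I \<longrightarrow>
       block_norm1 p (b k) = \<eta> \<longrightarrow> (\<Sum>i<N. v i * y i) = c)" for I and v :: "nat \<Rightarrow> real" and c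
  have "\<forall>I. \<exists>v c. P I v c"
    unfolding P_def using nn_lasso_block_norm_hyperplane[OF assms(3-5)] by (rule allI)
  then obtain v c where P: "\<And>I. P I (v I) (c I)"
    by metis
  then have v: "\<And>I. \<exists>i<N. v I i \<noteq> 0"
    unfolding P_def by blast
  have "AE e in M. \<forall>I\<in>Pow ({..<N} \<times> {..<p}). (\<Sum>i<N. v I i * \<epsilon> i e) \<noteq> c I - (\<Sum>i<N. v I i * ybar i)"
    by (intro AE_finite_allI prob_gaussian_hyperplane[OF noise] v) auto
  with lasso show ?thesis
  proof eventually_elim
    case (elim e)
    let ?I = "{(k, s). k < N \<and> s < p \<and> b e k s \<noteq> 0}"
    have "?I \<in> Pow ({..<N} \<times> {..<p})" by auto
    with elim have "(\<Sum>i<N. v ?I i * \<epsilon> i e) \<noteq> c ?I - (\<Sum>i<N. v ?I i * ybar i)" by blast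
    then have "(\<Sum>i<N. v ?I i * (ybar i + \<epsilon> i e)) \<noteq> c ?I"
      by (simp add: distrib_left sum.distrib)
    then show ?case
      using P[of ?I] elim(1) unfolding P_def by blast
  qed
qed

text \<open>Uniformly large noise has positive probability and forces a large block, so the blocks
  cannot all be almost surely below \<open>\<eta>\<close>.\<close>

lemma prob_large_block_pos:
  assumes noise: "gaussian_noise M N \<sigma> \<epsilon>" "0 < \<sigma>" and "0 < dt" "1 < N" "1 \<le> p" "1 \<le> \<tau>"
    and lasso: "AE e in M. is_nn_lasso N p (dictionary N dt \<tau> \<theta>1 \<theta>2) (\<lambda>i. ybar i + \<epsilon> i e) r (b e)"
    and meas: "\<And>k. k < N \<Longrightarrow> (\<lambda>e. block_norm1 p (b e k)) \<in> borel_measurable M"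
  shows "\<exists>k<N. 0 < prob {e \<in> space M. \<eta> \<le> block_norm1 p (b e k)}"
proof (rule ccontr)
  assume "\<not> ?thesis"
  then have "prob {e \<in> space M. \<eta> \<le> block_norm1 p (b e k)} = 0" if "k < N" for k
    using that measure_nonneg[of M] by (metis less_le)
  moreover have "{e \<in> space M. \<eta> \<le> block_norm1 p (b e k)} \<in> events" if "k < N" for k
    using meas[OF that] by measurable
  ultimately have "AE e in M. \<not> \<eta> \<le> block_norm1 p (b e k)" if "k < N" for k
    using that by (simp add: prob_Collect_eq_0)
  then have small: "AE e in M. \<forall>k\<in>{..<N}. \<not> \<eta> \<le> block_norm1 p (b e k)"
    by (intro AE_finite_allI) auto
  obtain R where R: "\<And>y b. is_nn_lasso N p (dictionary N dt \<tau> \<theta>1 \<theta>2) y r b \<Longrightarrow> (\<forall>i<N. R \<le> y i) \<Longrightarrow>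
      \<exists>k<N. \<eta> \<le> block_norm1 p (b k)"
    using nn_lasso_large_block[OF assms(3-6)] by metis
  \<comment> \<open>The added sum absorbs the noise-free part of the samples, whatever its
    sign.\<close>
  define R' where "R' = R + (\<Sum>i<N. \<bar>ybar i\<bar>)"
  have R': "R \<le> ybar i + x" if "i < N" "R' < x" for i x
  proof -
    have "\<bar>ybar i\<bar> \<le> (\<Sum>i<N. \<bar>ybar i\<bar>)"
      using that by (intro member_le_sum) auto
    with that show ?thesis by (simp add: R'_def)
  qed
  have "AE e in M. \<not> (\<forall>i<N. R' < \<epsilon> i e)"
    using lasso small
  proof eventually_elim
    case (elim e)
    then show ?case
      using R[OF elim(1)] R' by auto
  qed
  moreover have "random_variable borel (\<epsilon> i)" if "i < N" for i
    using noise that distributed_measurable by (fastforce simp: gaussian_noise_def)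
  ultimately have "prob {e \<in> space M. \<forall>i<N. R' < \<epsilon> i e} = 0"
    by (subst prob_Collect_eq_0) auto
  moreover have "0 < prob {e \<in> space M. \<forall>i<N. R' < \<epsilon> i e}"
    using prob_gaussian_orthant_pos[OF noise] \<open>1 < N\<close> by simp
  ultimately show False by simp
qed

end

section \<open>The bound with high probability\<close>

text \<open>The sample path \<open>\<omega>\<close> is fixed, so \<open>P0\<close> and
  \<open>\<alpha>\<close> are constants and the probabilities refer to the noise on
  \<open>Q\<close>. The number of nonzero entries of the estimator is random and therefore enters
  the bounds through its expectation.\<close>

theorem theorem1:
  fixes S :: "'w measure" and Q :: "'e measure" and \<omega> :: 'w
    and N p \<tau> :: nat and dt lam \<sigma> Emin Emax :: real
    and T E :: "nat \<Rightarrow> 'w \<Rightarrow> real" and M :: "'w \<Rightarrow> nat"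
    and \<Phi> :: "nat \<Rightarrow> real \<Rightarrow> real" and \<epsilon> :: "nat \<Rightarrow> 'e \<Rightarrow> real"
    and \<theta>1 \<theta>2 :: "nat \<Rightarrow> real" and A :: "nat \<Rightarrow> nat \<Rightarrow> nat \<Rightarrow> real"
    and ybar :: "nat \<Rightarrow> real" and y :: "'e \<Rightarrow> nat \<Rightarrow> real" and P0 :: "nat set"
    and \<beta> :: "nat \<Rightarrow> nat \<Rightarrow> real" and bhat :: "'e \<Rightarrow> nat \<Rightarrow> nat \<Rightarrow> real"
    and g \<alpha> r \<eta> \<rho> \<mu> :: real and a\<rho> a\<mu> :: int
  assumes N: "even N" "0 < N" and dt: "0 < dt" and p: "1 \<le> p" and \<tau>: "1 \<le> \<tau>"
    \<comment> \<open>random arrival times and energies, of which a sample path \<open>\<omega>\<close> is fixed\<close>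
    and S: "prob_space S" "poisson_arrivals S lam T" "iid S {1..} E"
           "M \<in> measurable S (count_space UNIV)"
    and Emin: "0 < Emin"
    and E: "\<forall>w\<in>space S. \<forall>n\<ge>1. Emin \<le> E n w \<and> E n w \<le> Emax"
    and \<omega>: "\<omega> \<in> space S"
    and P0: "P0 = arrival_bins dt (M \<omega>) (\<lambda>n. T n \<omega>)" "P0 \<subseteq> {..<N}"
    and ybar: "ybar = clean_signal dt (M \<omega>) (\<lambda>n. T n \<omega>) (\<lambda>n. E n \<omega>) \<Phi>"
    \<comment> \<open>noise\<close>
    and Q: "prob_space Q" and \<sigma>: "0 < \<sigma>" and noise: "gaussian_noise Q N \<sigma> \<epsilon>"
    and y: "y = (\<lambda>e i. ybar i + \<epsilon> i e)"
    \<comment> \<open>approximate model\<close>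
    and A: "A = dictionary N dt \<tau> \<theta>1 \<theta>2"
    and g: "g = min_sqrt_gram N p A"
    and \<beta>_off: "\<forall>k<N. k \<notin> P0 \<longrightarrow> (\<forall>s<p. \<beta> k s = 0)"
    and \<beta>_on: "\<forall>k\<in>P0. (\<forall>s<p. 0 \<le> \<beta> k s) \<and>
                  Emin \<le> 1 / sqrt (real N) * L2_set (block_apply p A k (\<beta> k)) {..<N} \<and>
                  1 / sqrt (real N) * L2_set (block_apply p A k (\<beta> k)) {..<N} \<le> Emax"
    and \<alpha>: "\<alpha> = L2_set (\<lambda>i. ybar i - dict_apply N p A \<beta> i) {..<N} / sqrt (real N)"
    \<comment> \<open>estimator\<close>
    and bhat_meas: "\<forall>k<N. \<forall>s<p. (\<lambda>e. bhat e k s) \<in> borel_measurable Q"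
    and bhat: "AE e in Q. is_nn_lasso N p A (y e) r (bhat e)"
    and r: "0 < r" "r + \<alpha> < Emin\<^sup>2 * g / (2 * Emax)"
    and \<eta>: "\<eta> = Emin\<^sup>2 * g / (4 * (2 * real \<tau> + 1) * Emax)"
    and \<rho>: "0 \<le> \<rho>" "\<rho> \<le> 1" and \<mu>: "0 \<le> \<mu>" "\<mu> \<le> 1"
    and level_\<rho>:
      "\<forall>k\<in>P0. \<P>(e in Q. \<exists>m\<in>corr_nbhd N p A \<rho> k. \<eta> \<le> block_norm1 p (bhat e m)) >
         1 - real p * tail (sqrt (real N) * (Emin\<^sup>2 * g / (4 * Emax * \<sigma>)))
           - real p * (2 * real \<tau> + 1) * tail (sqrt (real N) * ((r - \<alpha>) / \<sigma>))"
    and level_\<mu>: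
      "\<forall>k<N. \<P>(e in Q. \<eta> \<le> block_norm1 p (bhat e k)) > 0 \<longrightarrow>
         \<P>(e in Q. \<eta> \<le> block_norm1 p (bhat e k) \<longrightarrow> P0 \<inter> corr_nbhd N p A \<mu> k \<noteq> {}) >
         1 - (\<integral>e. real (block_norm0 p (bhat e k)) \<partial>Q)
               * tail (sqrt (real N) * ((r - \<alpha>) / \<sigma>))"
    and radius: "is_corr_radius N p \<tau> A \<rho> a\<rho>" "is_corr_radius N p \<tau> A \<mu> a\<mu>"
  shows
    "\<P>(e in Q.
        let b = threshold p \<eta> (bhat e);
            Mh = num_arrivals_est N p b;
            Th = arrival_est N p dt b;
            lh = rate_est N p dt b
        in ereal lh - rate_opt dt P0 \<le>
           ereal (lh * (1 - (Th Mh / dt) / (real_of_int a\<rho> + real (Max (block_support N p b)))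
                          * (real (num_intervals (\<Union>j\<in>{1..Mh}. nbhd N (real_of_int a\<mu>) (Th j / dt)))
                             / real Mh)))) >
       1 - real p * tail (sqrt (real N) * (Emin\<^sup>2 * g / (4 * Emax * \<sigma>)))
         - real p * (2 * real \<tau> + 1) * tail (sqrt (real N) * ((r - \<alpha>) / \<sigma>))
         - (\<integral>e. real (norm0 N p (bhat e)) \<partial>Q) * tail (sqrt (real N) * ((r - \<alpha>) / \<sigma>))"
proof -
  interpret Q: prob_space Q by (rule Q)

  \<comment> \<open>Signs of the constants, measurability, and comparison of \<open>\<alpha>\<close>
    with \<open>r\<close>\<close>
  define t1 where "t1 = tail (sqrt (real N) * (Emin\<^sup>2 * g / (4 * Emax * \<sigma>)))"
  define t2 where "t2 = tail (sqrt (real N) * ((r - \<alpha>) / \<sigma>))"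
  define n0 where "n0 k = (\<integral>e. real (block_norm0 p (bhat e k)) \<partial>Q)" for k
  define X where "X e = {k \<in> {..<N}. \<eta> < block_norm1 p (bhat e k)}" for e
  have "1 < N"
    using N by (cases "N = 1") auto
  have "0 < Emax"
    using E \<omega> Emin by (meson le_refl less_le_trans order_trans)
  have "0 \<le> \<alpha>"
    unfolding \<alpha> by simp
  then have "0 < Emin\<^sup>2 * g / (2 * Emax)"
    using r by linarith
  \<comment> \<open>Positivity of \<open>g\<close> is forced by the upper bound on
    \<open>r + \<alpha>\<close>.\<close>
  then have "0 < g"
    using \<open>0 < Emax\<close> Emin by (simp add: zero_less_divide_iff zero_less_mult_iff)
  then have "0 < \<eta>"
    using \<open>0 < Emax\<close> Emin by (simp add: \<eta>)
  have "0 < t1"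
    unfolding t1_def using \<open>0 < g\<close> \<open>0 < Emax\<close> Emin \<sigma> N by (intro tail_pos) simp
  have "finite P0"
    using P0(2) finite_subset by blast
  have supp: "block_support N p (threshold p \<eta> (bhat e)) = X e" for e
    using \<open>0 < \<eta>\<close> by (simp add: block_support_threshold X_def)
  have meas1: "(\<lambda>e. block_norm1 p (bhat e k)) \<in> borel_measurable Q" if "k < N" for k
    unfolding block_norm1_def using bhat_meas that
    by (intro borel_measurable_sum borel_measurable_abs) simp
  have lasso: "AE e in Q. is_nn_lasso N p A (\<lambda>i. ybar i + \<epsilon> i e) r (bhat e)"
    using bhat unfolding y .
  have sets_large: "{e \<in> space Q. \<eta> \<le> block_norm1 p (bhat e k)} \<in> sets Q" if "k < N" for k
    using meas1[OF that] by measurable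

  have meas0: "integrable Q (\<lambda>e. real (block_norm0 p (bhat e k)))" if "k < N" for k
  proof (rule Q.integrable_const_bound[of _ "real p"])
    have "block_norm0 p c \<le> card {..<p}" for c
      unfolding block_norm0_def by (rule card_mono) auto
    then show "AE e in Q. norm (real (block_norm0 p (bhat e k))) \<le> real p"
      by simp
    have "(\<lambda>e. if bhat e k s \<noteq> 0 then 1 else 0 :: real) \<in> borel_measurable Q" if "s < p" for s
    proof -
      have "(\<lambda>e. bhat e k s) \<in> borel_measurable Q"
        using bhat_meas \<open>k < N\<close> that by blast
      then show ?thesis by measurable
    qed
    then show "(\<lambda>e. real (block_norm0 p (bhat e k))) \<in> borel_measurable Q"
      unfolding block_norm0_eq_sum by (intro borel_measurable_sum) simp
  qed
  have norm0: "(\<integral>e. real (norm0 N p (bhat e)) \<partial>Q) = (\<Sum>k<N. n0 k)"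
    unfolding norm0_eq_sum n0_def of_nat_sum
    by (rule Bochner_Integration.integral_sum) (simp add: meas0)
  have n0_nonneg: "0 \<le> n0 k" for k
    unfolding n0_def by simp

  have "\<alpha> < r"
  proof (rule ccontr)
    assume "\<not> \<alpha> < r"
    then have "t2 \<le> 0"
      unfolding t2_def using \<sigma> by (intro tail_nonpos mult_nonneg_nonpos divide_nonpos_pos) auto
    obtain k where "k < N" "0 < \<P>(e in Q. \<eta> \<le> block_norm1 p (bhat e k))"
      using Q.prob_large_block_pos[OF noise \<sigma> dt \<open>1 < N\<close> p \<tau> lasso[unfolded A] meas1] by blast
    \<comment> \<open>The second level applies because this block is large with positive
      probability; as \<open>t2 \<le> 0\<close>, it demands a probability above 1.\<close>
    then have "1 - n0 k * t2 < \<P>(e in Q. \<eta> \<le> block_norm1 p (bhat e k) \<longrightarrow> P0 \<inter> corr_nbhd N p A \<mu> k \<noteq> {})"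
      using level_\<mu> unfolding n0_def t2_def by blast
    also have "\<dots> \<le> 1"
      by (rule Q.prob_le_1)
    finally show False
      using mult_nonneg_nonpos[OF n0_nonneg \<open>t2 \<le> 0\<close>, of k] by simp
  qed
  then have "0 < t2"
    unfolding t2_def using \<sigma> N by (intro tail_pos) simp

  \<comment> \<open>Exceptional events and their probabilities\<close>
  define miss where "miss = {e \<in> space Q. P0 \<noteq> {} \<and>
      \<not> (\<exists>m\<in>corr_nbhd N p A \<rho> (Max P0). \<eta> \<le> block_norm1 p (bhat e m))}"
  define spurious where "spurious k = {e \<in> space Q.
      \<not> (\<eta> \<le> block_norm1 p (bhat e k) \<longrightarrow> P0 \<inter> corr_nbhd N p A \<mu> k \<noteq> {})}" for k
  have sets_miss: "{e \<in> space Q. \<exists>m\<in>corr_nbhd N p A \<rho> k. \<eta> \<le> block_norm1 p (bhat e m)} \<in> sets Q" for k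
    by (intro sets.sets_Collect_finite_Ex sets_large)
      (auto simp: corr_nbhd_def intro: finite_subset[of _ "{..<N}"])
  have sets_spurious: "spurious k \<in> sets Q" if "k < N" for k
    using sets_large[OF that] by (cases "P0 \<inter> corr_nbhd N p A \<mu> k = {}") (simp_all add: spurious_def)
  have miss: "miss \<in> sets Q" "Q.prob miss < real p * t1 + real p * (2 * real \<tau> + 1) * t2"
  proof -
    have "miss \<in> sets Q \<and> Q.prob miss < real p * t1 + real p * (2 * real \<tau> + 1) * t2"
    proof (cases "P0 = {}")
      case True
      then have "miss = {}" by (simp add: miss_def)
      \<comment> \<open>The strictness of the final inequality comes from \<open>miss\<close>;
        without arrivals it rests on positive tail terms.\<close>
      moreover have "0 < real p * t1 + real p * (2 * real \<tau> + 1) * t2"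
        using p \<open>0 < t1\<close> \<open>0 < t2\<close> by (intro add_pos_nonneg mult_pos_pos mult_nonneg_nonneg) auto
      ultimately show ?thesis by simp
    next
      case False
      let ?hit = "{e \<in> space Q. \<exists>m\<in>corr_nbhd N p A \<rho> (Max P0). \<eta> \<le> block_norm1 p (bhat e m)}"
      have "miss = space Q - ?hit"
        using False by (auto simp: miss_def)
      \<comment> \<open>The first level is used for the last arrival only, so no factor
        \<open>card P0\<close> appears.\<close>
      moreover have "1 - real p * t1 - real p * (2 * real \<tau> + 1) * t2 < Q.prob ?hit"
        using level_\<rho> Max_in[OF \<open>finite P0\<close> False] unfolding t1_def t2_def by blast
      ultimately show ?thesis
        using Q.prob_compl[OF sets_miss[of "Max P0"]] sets_miss[of "Max P0"] by auto
    qed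
    then show "miss \<in> sets Q" "Q.prob miss < real p * t1 + real p * (2 * real \<tau> + 1) * t2"
      by blast+
  qed
  have spurious: "Q.prob (spurious k) \<le> n0 k * t2" if "k < N" for k
  proof (cases "0 < \<P>(e in Q. \<eta> \<le> block_norm1 p (bhat e k))")
    case True
    have "\<P>(e in Q. \<eta> \<le> block_norm1 p (bhat e k) \<longrightarrow> P0 \<inter> corr_nbhd N p A \<mu> k \<noteq> {})
        = Q.prob (space Q - spurious k)"
      by (rule arg_cong[of _ _ Q.prob]) (auto simp: spurious_def)
    moreover have "1 - n0 k * t2 < \<P>(e in Q. \<eta> \<le> block_norm1 p (bhat e k) \<longrightarrow> P0 \<inter> corr_nbhd N p A \<mu> k \<noteq> {})"
      using level_\<mu> True \<open>k < N\<close> unfolding n0_def t2_def by blast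
    ultimately show ?thesis
      using Q.prob_compl[OF sets_spurious[OF that]] by simp
  next
    case False
    \<comment> \<open>The second level says nothing about such a block, but a spurious detection
      there lies in a null event.\<close>
    have "Q.prob (spurious k) \<le> \<P>(e in Q. \<eta> \<le> block_norm1 p (bhat e k))"
      by (rule Q.finite_measure_mono[OF _ sets_large[OF that]]) (auto simp: spurious_def)
    also have "\<dots> \<le> 0"
      using False by simp
    also have "0 \<le> n0 k * t2"
      using n0_nonneg \<open>0 < t2\<close> by simp
    finally show ?thesis .
  qed

  \<comment> \<open>Failure of the rate bound forces an exceptional event\<close>
  define good where "good = {e \<in> space Q.
        let b = threshold p \<eta> (bhat e);
            Mh = num_arrivals_est N p b;
            Th = arrival_est N p dt b;
            lh = rate_est N p dt b
        in ereal lh - rate_opt dt P0 \<le>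
           ereal (lh * (1 - (Th Mh / dt) / (real_of_int a\<rho> + real (Max (block_support N p b)))
                          * (real (num_intervals (\<Union>j\<in>{1..Mh}. nbhd N (real_of_int a\<mu>) (Th j / dt)))
                             / real Mh)))}"
  \<comment> \<open>The rate bound sees the noise only through the set of retained blocks, which
    makes \<open>good\<close> measurable.\<close>
  have "\<exists>R. good = {e \<in> space Q. R (X e)}"
    unfolding good_def Let_def rate_est_def num_arrivals_est_def arrival_est_def onsets_def supp
    by (rule exI) (rule refl)
  then obtain R where R: "good = {e \<in> space Q. R (X e)}"
    by blast
  have "good \<in> sets Q"
    unfolding R X_def using meas1 by (intro sets_Collect_superlevel) auto
  have radius_\<rho>: "0 \<le> a\<rho>" "\<And>k. k < N \<Longrightarrow> corr_nbhd N p A \<rho> k \<subseteq> nbhd N (real_of_int a\<rho>) (real k)"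
    using corr_nbhd_subset_nbhd[OF dt p \<tau> \<rho>(1) radius(1)[unfolded A]] unfolding A by blast+
  have radius_\<mu>: "\<And>k. k < N \<Longrightarrow> corr_nbhd N p A \<mu> k \<subseteq> nbhd N (real_of_int a\<mu>) (real k)"
    using corr_nbhd_subset_nbhd[OF dt p \<tau> \<mu>(1) radius(2)[unfolded A]] unfolding A by blast

  \<comment> \<open>Without ties, detection in the sense of the levels, with
    \<open>\<eta> \<le>\<close>, implies membership in \<open>X e\<close>, with
    \<open>\<eta> <\<close>.\<close>
  have "AE e in Q. \<forall>k\<in>{..<N}. block_norm1 p (bhat e k) \<noteq> \<eta>"
    by (intro AE_finite_allI Q.AE_block_norm_neq[OF noise \<sigma> \<open>0 < N\<close> \<open>0 < \<eta>\<close> _ lasso]) auto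
  then have "AE e in Q. e \<in> space Q - good \<longrightarrow> e \<in> miss \<union> (\<Union>k<N. spurious k)"
  proof eventually_elim
    case (elim e)
    show ?case
    proof (rule impI, rule ccontr)
      assume e: "e \<in> space Q - good" and "e \<notin> miss \<union> (\<Union>k<N. spurious k)"
      then have hit: "P0 \<noteq> {} \<Longrightarrow> \<exists>m\<in>corr_nbhd N p A \<rho> (Max P0). \<eta> \<le> block_norm1 p (bhat e m)"
        and true: "\<And>k. k < N \<Longrightarrow> \<eta> \<le> block_norm1 p (bhat e k) \<Longrightarrow> P0 \<inter> corr_nbhd N p A \<mu> k \<noteq> {}"
        by (auto simp: miss_def spurious_def)
      have "\<exists>m\<in>X e. real (Max P0) \<le> real_of_int a\<rho> + real m" if nonempty: "P0 \<noteq> {}"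
      proof -
        obtain m where m: "m \<in> corr_nbhd N p A \<rho> (Max P0)" "\<eta> \<le> block_norm1 p (bhat e m)"
          using hit[OF nonempty] by blast
        have "Max P0 < N"
          using Max_in[OF \<open>finite P0\<close> nonempty] P0(2) by blast
        then have "m \<in> nbhd N (real_of_int a\<rho>) (real (Max P0))"
          using m(1) radius_\<rho>(2) by blast
        then show ?thesis
          using m(2) elim by (intro bexI[of _ m]) (force simp: nbhd_def X_def)+
      qed
      moreover have "P0 \<inter> nbhd N (real_of_int a\<mu>) (real k) \<noteq> {}" if "k \<in> X e" for k
        using true[of k] radius_\<mu>[of k] that by (auto simp: X_def)
      ultimately have "e \<in> good"
        using e rate_bound[OF dt \<open>finite P0\<close> radius_\<rho>(1) supp[of e, symmetric]]
        unfolding good_def Let_def supp by blast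
      with e show False by blast
    qed
  qed
  then have "Q.prob (space Q - good) \<le> Q.prob (miss \<union> (\<Union>k<N. spurious k))"
    using miss(1) sets_spurious by (intro Q.finite_measure_mono_AE) auto
  also have "\<dots> \<le> Q.prob miss + Q.prob (\<Union>k<N. spurious k)"
    using miss(1) sets_spurious by (intro measure_Un_le) auto
  also have "Q.prob (\<Union>k<N. spurious k) \<le> (\<Sum>k<N. Q.prob (spurious k))"
    using sets_spurious by (intro Q.finite_measure_subadditive_finite) auto
  also have "\<dots> \<le> (\<Sum>k<N. n0 k * t2)"
    using spurious by (intro sum_mono) auto
  finally have "1 - real p * t1 - real p * (2 * real \<tau> + 1) * t2 - (\<Sum>k<N. n0 k) * t2 < Q.prob good"
    using miss(2) Q.prob_compl[OF \<open>good \<in> sets Q\<close>] by (simp add: sum_distrib_right)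
  then show ?thesis
    unfolding good_def t1_def t2_def norm0 .
qed

end
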